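(* Let $\big((X_n, \xi_n)_{n\in \mathbb{N}_\infty}, \mathcal{M}\big)$ be a Banach stacking. Suppose $(A_n)_{n\in\mathbb{N}_\infty}$ is a sequence of $\omega_n$-accretive operators $A_n$ on $X_n$ that each satisfy the range condition, where the sequence $(\omega_n)_{n\in \mathbb{N}_{\infty}}$ of real numbers is bounded above by some constant $\omega\in \mathbb{R}$. Suppose that, for all $(x_\infty,y_\infty)\in A_\infty$, there exists a sequence $\big((x_n,y_n)\big)_{n\in \mathbb{N}}$ with $(x_n,y_n)\in A_n$ for all $n\in\mathbb{N}$ such that $x_n\twoheadrightarrow x_{\infty}$ and $y_n\twoheadrightarrow y_{\infty}$ as $n\to\infty$. Then, for all $\lambda \in \mathfrak{I}_{\omega}$ and all sequences $(z_n)_{n\in\mathbb{N}_\infty}$ with $z_n\in\overline{D(A_n)}$ for all $n\in\mathbb{N}_\infty$ and $z_n \twoheadrightarrow z_{\infty}$ as $n\to\infty$, we have $R_\lambda(A_n)z_n\twoheadrightarrow R_\lambda(A_\infty)z_{\infty}$ as $n\to\infty$. Moreover, for all such sequences $(z_n)_{n\in\mathbb{N}_\infty}$ and for all $t\geq 0$, $S_{A_n}(t)z_n \twoheadrightarrow S_{A_{\infty}}(t)z_{\infty}$ as $n\rightarrow \infty$ and, for all $T\in [0,+\infty)$, the convergence is uniform in $t$ on the interval $[0,T]$, i.e. $\sup_{t\in[0,T]} d\big(\xi_n(S_{A_n}(t)z_n),\xi_\infty(S_{A_\infty}(t)z_\infty)\big)\to 0$ as $n\to\infty$.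
   Context: $\mathbb{N}=\{1,2,\dots\}$ and $\mathbb{N}_\infty=\mathbb{N}\cup\{\infty\}$; Banach spaces are over $\mathbb{R}$. Banach stacking: Let $(X_n,\|\cdot\|_n)_{n\in\mathbb{N}_\infty}$ be Banach spaces, $(\mathcal{M},d)$ a metric space and $\xi_n:X_n\to\mathcal{M}$ maps ($n\in\mathbb{N}_\infty$). For $x_n\in X_n$ ($n\in\mathbb{N}_\infty$), write $x_n\twoheadrightarrow x_\infty$ as $n\to\infty$ if $\xi_n(x_n)\to\xi_\infty(x_\infty)$ in $\mathcal{M}$. The collection $\big((X_n,\xi_n)_{n\in\mathbb{N}_\infty},\mathcal{M}\big)$ is a Banach stacking if: (i) each $\xi_n$ is $1$-Lipschitz; (ii) for all $x_\infty\in X_\infty$ there are $x_n\in X_n$ ($n\in\mathbb{N}$) with $x_n\twoheadrightarrow x_\infty$; (iii) if $x_n\twoheadrightarrow x_\infty$ and $y_n\twoheadrightarrow y_\infty$ and $\lambda\in\mathbb{R}$, then $x_n+y_n\twoheadrightarrow x_\infty+y_\infty$ and $\lambda x_n\twoheadrightarrow\lambda x_\infty$; (iv) if $x_n\twoheadrightarrow x_\infty$ then $\|x_n\|_n\to\|x_\infty\|_\infty$. Operators: An operator on a Banach space $X$ is a subset $A\subset X\times X$; $A(x)=\{y:(x,y)\in A\}$, $D(A)=\{x: A(x)\ne\emptyset\}$, $\mathrm{Range}(A)=\bigcup_x A(x)$, $A^{-1}=\{(x,y):(y,x)\in A\}$, $I_X=\{(x,x):x\in X\}$, $A+B=\{(x,y+z):(x,y)\in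 A,(x,z)\in B\}$, $\lambda A=\{(x,\lambda y):(x,y)\in A\}$, and the resolvent is $R_\lambda(A)=(I_X+\lambda A)^{-1}$. $A$ is accretive if $\|x-\hat x+\lambda(y-\hat y)\|\ge\|x-\hat x\|$ for all $(x,y),(\hat x,\hat y)\in A$ and all $\lambda>0$; it is $\omega$-accretive if $A+\omega I_X$ is accretive. $\mathfrak{I}_\omega=(0,1/\omega)$ if $\omega>0$ and $\mathfrak{I}_\omega=(0,+\infty)$ if $\omega\le0$. If $A$ is $\omega$-accretive and $\lambda\in\mathfrak{I}_\omega$, then $R_\lambda(A)$ is single-valued and is regarded as a function $D(R_\lambda(A))=\mathrm{Range}(I_X+\lambda A)\to X$. $A$ satisfies the range condition if there is a $\delta>0$ such that $\mathrm{Range}(I_X+\lambda A)\supset\overline{D(A)}$ for all $\lambda\in(0,\delta)$. Semigroup: Consider the Cauchy problem $u'+Au\ni0$, $u(0)=x$. For $\varepsilon,T>0$, an $\varepsilon$-discretization of $[0,T]$ is a tuple $0=t_0<t_1<\dots<t_N\le T$ with $t_i-t_{i-1}\le\varepsilon$ and $T-\varepsilon<t_N\leq T$. An $\varepsilon$-approximate solution consists of such a discretization and $v_0,\dots,v_N,\theta_0=0,\theta_1,\dots,\theta_N\in X$ with $\|v_0-x\|\le\varepsilon$, $\theta_i\in\frac{v_i-v_{i-1}}{t_i-t_{i-1}}+A(v_i)$ for $1\le i\le N$, and $\sum_{i=1}^N(t_i-t_{i-1})\|\theta_i\|\le\varepsilon$; set $\bar v(0)=v_0$, $\bar v(t)=v_i$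 for $t\in(t_{i-1},t_i]$, $\bar v(t)=v_N$ for $t\in(t_N,T]$. A mild solution on $[0,T]$ is a $u\in C([0,T];X)$ with $u(0)=x$ such that for every $\varepsilon>0$ there is an $\varepsilon$-approximate solution with $\|u(t)-\bar v(t)\|\le\varepsilon$ for all $t\in[0,T]$; $u\in C([0,+\infty);X)$ is a mild solution on $[0,+\infty)$ if its restriction to each $[0,T]$ is a mild solution. $D(S_A)$ is the set of $x\in X$ for which a unique mild solution $u$ on $[0,+\infty)$ exists, and $S_A(t)x:=u(t)$ for $x\in D(S_A)$. (By the Crandall--Liggett theorem, if $A$ is $\omega$-accretive and satisfies the range condition, then $\overline{D(A)}\subset D(S_A)$.)
   Formalization: The resolvent convergence is stated for those z_n for which R_λ(A_∞)z_∞ and, for all large n, R_λ(A_n)z_n are defined; the range condition gives this only for small λ, so for some λ in I_ω the resolvent value may not exist. *)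

theory Defs
  imports "HOL-Analysis.Analysis"
begin

section \<open>Banach spaces on a carrier\<close>

text \<open>
  A sequence of different Banach spaces cannot be a sequence of types. A Banach space is therefore
  given by a linear subspace \<open>X\<close> of a real vector space and a function \<open>N\<close> which on \<open>X\<close> is a
  complete norm; the ambient vector space carries neither a norm nor a topology, and the values of
  \<open>N\<close> outside \<open>X\<close> play no role. A family of Banach spaces has one ambient vector space but
  unrelated norms. This is no loss of generality: any family of vector spaces is, up to
  isomorphism, a family of subspaces of its direct sum.
\<close>

definition norm_dist :: "'a::real_vector set \<Rightarrow> ('a \<Rightarrow> real) \<Rightarrow> 'a \<Rightarrow> 'a \<Rightarrow> real" where
  "norm_dist X N x y = (if x \<in> X \<and> y \<in> X then N (x - y) else 0)"
  (* the locale Metric_space wants a nonnegative symmetric function on the whole type *)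

definition norm_topology :: "'a::real_vector set \<Rightarrow> ('a \<Rightarrow> real) \<Rightarrow> 'a topology" where
  "norm_topology X N = Metric_space.mtopology X (norm_dist X N)"

definition normed_space_on :: "'a::real_vector set \<Rightarrow> ('a \<Rightarrow> real) \<Rightarrow> bool" where
  "normed_space_on X N \<longleftrightarrow>
     subspace X \<and>
     (\<forall>x\<in>X. N x = 0 \<longleftrightarrow> x = 0) \<and>
     (\<forall>x\<in>X. \<forall>y\<in>X. N (x + y) \<le> N x + N y) \<and>
     (\<forall>x\<in>X. \<forall>c. N (c *\<^sub>R x) = \<bar>c\<bar> * N x)"

definition banach_space_on :: "'a::real_vector set \<Rightarrow> ('a \<Rightarrow> real) \<Rightarrow> bool" where
  "banach_space_on X N \<longleftrightarrow>
     normed_space_on X N \<and> Metric_space.mcomplete X (norm_dist X N)"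

lemma normed_space_onD:
  assumes "normed_space_on X N"
  shows "subspace X"
    and "x \<in> X \<Longrightarrow> N x = 0 \<longleftrightarrow> x = 0"
    and "x \<in> X \<Longrightarrow> y \<in> X \<Longrightarrow> N (x + y) \<le> N x + N y"
    and "x \<in> X \<Longrightarrow> N (c *\<^sub>R x) = \<bar>c\<bar> * N x"
  using assms by (simp_all add: normed_space_on_def)

lemma normed_space_on_minus:
  assumes "normed_space_on X N" "x \<in> X"
  shows "N (- x) = N x"
  using normed_space_onD(4)[OF assms, of "-1"] by simp

lemma normed_space_on_nonneg:
  assumes "normed_space_on X N" "x \<in> X"
  shows "0 \<le> N x"
proof -
  note X = normed_space_onD(1)[OF assms(1)]
  have "N (x + - x) \<le> N x + N (- x)"
    by (rule normed_space_onD(3)[OF assms(1) assms(2) subspace_neg[OF X assms(2)]])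
  moreover have "N 0 = 0"
    using normed_space_onD(2)[OF assms(1) subspace_0[OF X]] by simp
  ultimately show ?thesis
    using normed_space_on_minus[OF assms] by simp
qed

lemma Metric_space_norm_dist:
  assumes "normed_space_on X N"
  shows "Metric_space X (norm_dist X N)"
proof
  note X = normed_space_onD(1)[OF assms]
  show "0 \<le> norm_dist X N x y" for x y
    using normed_space_on_nonneg[OF assms subspace_diff[OF X]] by (simp add: norm_dist_def)
  have sym: "N (x - y) = N (y - x)" if "x \<in> X" "y \<in> X" for x y
    using normed_space_on_minus[OF assms subspace_diff[OF X that]] by simp
  show "norm_dist X N x y = norm_dist X N y x" for x y
  proof (cases "x \<in> X \<and> y \<in> X")
    case True
    then show ?thesis using sym[of x y] by (simp add: norm_dist_def)
  next
    case False
    then show ?thesis by (auto simp: norm_dist_def)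
  qed
  show "norm_dist X N x y = 0 \<longleftrightarrow> x = y" if "x \<in> X" "y \<in> X" for x y
    using normed_space_onD(2)[OF assms subspace_diff[OF X that]] that by (simp add: norm_dist_def)
  show "norm_dist X N x z \<le> norm_dist X N x y + norm_dist X N y z"
    if "x \<in> X" "y \<in> X" "z \<in> X" for x y z
    using normed_space_onD(3)[OF assms subspace_diff[OF X that(1,2)] subspace_diff[OF X that(2,3)]]
      that by (simp add: norm_dist_def)
qed

section \<open>Banach stackings\<close>

text \<open>
  The index set \<open>\<nat> \<union> {\<infinity>}\<close> is the type \<^typ>\<open>enat\<close>; sequences start at index 0 instead of 1.
\<close>

definition stack_tendsto ::
    "(enat \<Rightarrow> 'a \<Rightarrow> 'm::metric_space) \<Rightarrow> (nat \<Rightarrow> 'a) \<Rightarrow> 'a \<Rightarrow> bool" where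
  "stack_tendsto \<xi> x p \<longleftrightarrow> (\<lambda>n. \<xi> (enat n) (x n)) \<longlonglongrightarrow> \<xi> \<infinity> p"

definition banach_stacking ::
    "(enat \<Rightarrow> 'a::real_vector set) \<Rightarrow> (enat \<Rightarrow> 'a \<Rightarrow> real) \<Rightarrow>
     (enat \<Rightarrow> 'a \<Rightarrow> 'm::metric_space) \<Rightarrow> bool" where
  "banach_stacking X N \<xi> \<longleftrightarrow>
     (\<forall>n. banach_space_on (X n) (N n)) \<and>
     (\<forall>n. \<forall>x\<in>X n. \<forall>y\<in>X n. dist (\<xi> n x) (\<xi> n y) \<le> N n (x - y)) \<and>
     (\<forall>p\<in>X \<infinity>. \<exists>x. (\<forall>n. x n \<in> X (enat n)) \<and> stack_tendsto \<xi> x p) \<and>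
     (\<forall>x y p q c.
        (\<forall>n. x n \<in> X (enat n)) \<and> (\<forall>n. y n \<in> X (enat n)) \<and> p \<in> X \<infinity> \<and> q \<in> X \<infinity> \<and>
        stack_tendsto \<xi> x p \<and> stack_tendsto \<xi> y q \<longrightarrow>
          stack_tendsto \<xi> (\<lambda>n. x n + y n) (p + q) \<and>
          stack_tendsto \<xi> (\<lambda>n. c *\<^sub>R x n) (c *\<^sub>R p)) \<and>
     (\<forall>x p.
        (\<forall>n. x n \<in> X (enat n)) \<and> p \<in> X \<infinity> \<and> stack_tendsto \<xi> x p \<longrightarrow>
          (\<lambda>n. N (enat n) (x n)) \<longlonglongrightarrow> N \<infinity> p)"

section \<open>Operators\<close>

text \<open>
  Operators on \<open>X\<close> are subsets of \<open>X \<times> X\<close>; \<open>D(A)\<close> is \<^term>\<open>Domain A\<close>, \<open>A(x)\<close> is \<open>A `` {x}\<close>, and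
  \<open>I\<^sub>X\<close> is \<^term>\<open>Id_on X\<close>.
\<close>

definition op_plus :: "('a::real_vector \<times> 'a) set \<Rightarrow> ('a \<times> 'a) set \<Rightarrow> ('a \<times> 'a) set" where
  "op_plus A B = {(x, y + z) | x y z. (x, y) \<in> A \<and> (x, z) \<in> B}"

definition op_scale :: "real \<Rightarrow> ('a::real_vector \<times> 'a) set \<Rightarrow> ('a \<times> 'a) set" where
  "op_scale l A = {(x, l *\<^sub>R y) | x y. (x, y) \<in> A}"

definition resolvent :: "'a::real_vector set \<Rightarrow> real \<Rightarrow> ('a \<times> 'a) set \<Rightarrow> ('a \<times> 'a) set" where
  "resolvent X l A = (op_plus (Id_on X) (op_scale l A))\<inverse>"

text \<open>The value at \<open>z\<close> of a single-valued operator, meaningful for \<open>z\<close> in its domain only.\<close>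

definition op_apply :: "('a \<times> 'a) set \<Rightarrow> 'a \<Rightarrow> 'a" where
  "op_apply R z = (THE y. (z, y) \<in> R)"

definition accretive :: "('a::real_vector \<Rightarrow> real) \<Rightarrow> ('a \<times> 'a) set \<Rightarrow> bool" where
  "accretive N A \<longleftrightarrow>
     (\<forall>x y x' y' l. (x, y) \<in> A \<and> (x', y') \<in> A \<and> 0 < l \<longrightarrow>
        N (x - x') \<le> N (x - x' + l *\<^sub>R (y - y')))"

definition omega_accretive ::
    "'a::real_vector set \<Rightarrow> ('a \<Rightarrow> real) \<Rightarrow> real \<Rightarrow> ('a \<times> 'a) set \<Rightarrow> bool" where
  "omega_accretive X N w A \<longleftrightarrow> accretive N (op_plus A (op_scale w (Id_on X)))"

definition resolvent_interval :: "real \<Rightarrow> real set" where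
  "resolvent_interval w = (if 0 < w then {0<..<1 / w} else {0<..})"

definition range_condition ::
    "'a::real_vector set \<Rightarrow> ('a \<Rightarrow> real) \<Rightarrow> ('a \<times> 'a) set \<Rightarrow> bool" where
  "range_condition X N A \<longleftrightarrow>
     (\<exists>\<delta>>0. \<forall>l\<in>{0<..<\<delta>}.
        norm_topology X N closure_of Domain A \<subseteq> Range (op_plus (Id_on X) (op_scale l A)))"

section \<open>Mild solutions and the semigroup\<close>

definition discretization :: "real \<Rightarrow> real \<Rightarrow> nat \<Rightarrow> (nat \<Rightarrow> real) \<Rightarrow> bool" where
  "discretization e T K t \<longleftrightarrow>
     t 0 = 0 \<and> (\<forall>i\<in>{1..K}. t (i - 1) < t i \<and> t i - t (i - 1) \<le> e) \<and> T - e < t K \<and> t K \<le> T"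

definition approx_solution ::
    "'a::real_vector set \<Rightarrow> ('a \<Rightarrow> real) \<Rightarrow> ('a \<times> 'a) set \<Rightarrow> 'a \<Rightarrow> real \<Rightarrow> real \<Rightarrow>
     nat \<Rightarrow> (nat \<Rightarrow> real) \<Rightarrow> (nat \<Rightarrow> 'a) \<Rightarrow> (nat \<Rightarrow> 'a) \<Rightarrow> bool" where
  "approx_solution X N A x e T K t v \<theta> \<longleftrightarrow>
     discretization e T K t \<and>
     (\<forall>i\<le>K. v i \<in> X \<and> \<theta> i \<in> X) \<and> \<theta> 0 = 0 \<and>
     N (v 0 - x) \<le> e \<and>
     (\<forall>i\<in>{1..K}. \<exists>y\<in>A `` {v i}. \<theta> i = (v i - v (i - 1)) /\<^sub>R (t i - t (i - 1)) + y) \<and>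
     (\<Sum>i=1..K. (t i - t (i - 1)) * N (\<theta> i)) \<le> e"

text \<open>
  For \<open>s \<le> t K\<close> the least \<open>i\<close> with \<open>s \<le> t i\<close> is 0 if \<open>s = 0\<close>, and otherwise the index with
  \<open>s \<in> {t (i - 1)<..t i}\<close>.
\<close>

definition step_interp :: "nat \<Rightarrow> (nat \<Rightarrow> real) \<Rightarrow> (nat \<Rightarrow> 'a) \<Rightarrow> real \<Rightarrow> 'a" where
  "step_interp K t v s = (if s \<le> t K then v (LEAST i. s \<le> t i) else v K)"

definition mild_solution_on ::
    "'a::real_vector set \<Rightarrow> ('a \<Rightarrow> real) \<Rightarrow> ('a \<times> 'a) set \<Rightarrow> 'a \<Rightarrow> real \<Rightarrow> (real \<Rightarrow> 'a) \<Rightarrow> bool" where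
  "mild_solution_on X N A x T u \<longleftrightarrow>
     continuous_map (top_of_set {0..T}) (norm_topology X N) u \<and> u 0 = x \<and>
     (\<forall>e>0. \<exists>K t v \<theta>. approx_solution X N A x e T K t v \<theta> \<and>
        (\<forall>s\<in>{0..T}. N (u s - step_interp K t v s) \<le> e))"

definition mild_solution ::
    "'a::real_vector set \<Rightarrow> ('a \<Rightarrow> real) \<Rightarrow> ('a \<times> 'a) set \<Rightarrow> 'a \<Rightarrow> (real \<Rightarrow> 'a) \<Rightarrow> bool" where
  "mild_solution X N A x u \<longleftrightarrow>
     continuous_map (top_of_set {0..}) (norm_topology X N) u \<and>
     (\<forall>T>0. mild_solution_on X N A x T u)"

text \<open>
  Solutions are functions on the whole of \<^typ>\<open>real\<close>, so uniqueness means agreement on \<open>{0..}\<close>.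
\<close>

definition mild_semigroup_domain ::
    "'a::real_vector set \<Rightarrow> ('a \<Rightarrow> real) \<Rightarrow> ('a \<times> 'a) set \<Rightarrow> 'a set" where
  "mild_semigroup_domain X N A =
     {x \<in> X. \<exists>u. mild_solution X N A x u \<and>
        (\<forall>v. mild_solution X N A x v \<longrightarrow> (\<forall>t\<ge>0. v t = u t))}"

text \<open>For \<open>x\<close> in \<^const>\<open>mild_semigroup_domain\<close> and \<open>t \<ge> 0\<close> this is \<open>S\<^sub>A(t)x\<close>, see the lemma below.\<close>

definition mild_semigroup ::
    "'a::real_vector set \<Rightarrow> ('a \<Rightarrow> real) \<Rightarrow> ('a \<times> 'a) set \<Rightarrow> real \<Rightarrow> 'a \<Rightarrow> 'a" where
  "mild_semigroup X N A t x = (THE y. \<exists>u. mild_solution X N A x u \<and> y = u t)"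

lemma mild_semigroup_eq:
  assumes "x \<in> mild_semigroup_domain X N A" "mild_solution X N A x u" "0 \<le> t"
  shows "mild_semigroup X N A t x = u t"
proof -
  obtain w where w: "\<forall>v. mild_solution X N A x v \<longrightarrow> (\<forall>t\<ge>0. v t = w t)"
    using assms(1) unfolding mild_semigroup_domain_def mem_Collect_eq by (elim conjE exE)
  have wt: "v t = w t" if "mild_solution X N A x v" for v
    using w[rule_format, OF that assms(3)] .
  show ?thesis
    unfolding mild_semigroup_def
  proof (rule the_equality)
    show "\<exists>v. mild_solution X N A x v \<and> u t = v t"
      by (intro exI[of _ u] conjI assms(2) refl)
    show "y = u t" if "\<exists>v. mild_solution X N A x v \<and> y = v t" for y
      using that
    proof (elim exE conjE)
      fix v assume v: "mild_solution X N A x v" and y: "y = v t"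
      show "y = u t" unfolding y wt[OF v] wt[OF assms(2)] ..
    qed
  qed
qed

end

theory Submission
  imports Defs
begin

text \<open>
  Two approximate solutions \<open>v\<close>, \<open>w\<close> of the Cauchy problem of one accretive operator satisfy a discrete
  transport inequality in the distances \<open>N (v i - w j)\<close>. Comparing them with an explicit
  supersolution (a form of Kobayashi's estimate, with the usual square root replaced by its quadratic
  majorants) bounds the distance in terms of the mesh, the time difference, \<open>N (z - x)\<close> and
  \<open>N y\<close>, for any \<open>(x, y)\<close> in the operator. This yields uniqueness of mild solutions and, applied to
  implicit Euler schemes, the Crandall--Liggett theorem. For the convergence of the semigroups, an
  approximate solution for \<open>A\<^sub>\<infinity>\<close> has finitely many nodes, so it lifts along the stacking to
  approximate solutions for \<open>A\<^sub>n\<close> on the same time grid; pairs \<open>(x\<^sub>n, y\<^sub>n) \<twoheadrightarrow> (x\<^sub>\<infinity>, y\<^sub>\<infinity>)\<close> make the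
  estimate uniform in \<open>n\<close>.
\<close>

section \<open>Distance of approximate solutions\<close>

text \<open>The square root of \<open>a\<^sup>2 + e * S\<close> is at most
  \<open>c / 2 + (a\<^sup>2 + e * S) / (2 * c)\<close> for every \<open>c > 0\<close>. A quadratic
  polynomial passes through the recursion by an algebraic identity, with no concavity argument, and
  \<open>c\<close> stays free until the final estimate. The initial point lies only in the closure
  of the domain, so the order of the choices matters: the tolerance fixes a radius \<open>r\<close>;
  then \<open>(x, y)\<close> is taken in the operator with \<open>x\<close> within \<open>r\<close>
  of \<open>z\<close>, at the price of an uncontrolled \<open>N y\<close>; only then are
  \<open>c\<close> and the mesh chosen, depending on \<open>N y\<close>. The range condition gives
  each operator its own threshold for the step size, which may shrink along the sequence. Hence no
  step size is known to serve the implicit Euler schemes of all operators at once. Lifting nodes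
  needs no resolvent of the approximating operators, but it produces small errors \<theta>, which
  the distance estimate has to tolerate.\<close>

lemma kobayashi_recursion:
  fixes b :: "nat \<Rightarrow> nat \<Rightarrow> real" and t s E F :: "nat \<Rightarrow> real"
  assumes t: "t 0 = 0" "\<And>i. i < K \<Longrightarrow> t i < t (Suc i)" "\<And>i. i < K \<Longrightarrow> t (Suc i) - t i \<le> e"
    and s: "s 0 = 0" "\<And>j. j < L \<Longrightarrow> s j < s (Suc j)" "\<And>j. j < L \<Longrightarrow> s (Suc j) - s j \<le> e"
    and e: "0 \<le> e" and c: "0 < c" and Y: "0 \<le> Y"
    and EF: "E 0 = 0" "F 0 = 0"
    and left: "\<And>i. i \<le> K \<Longrightarrow> b i 0 \<le> D + E i + t i * Y"
    and right: "\<And>j. j \<le> L \<Longrightarrow> b 0 j \<le> D + F j + s j * Y"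
    and step: "\<And>i j. i < K \<Longrightarrow> j < L \<Longrightarrow>
      (t (Suc i) - t i + (s (Suc j) - s j)) * b (Suc i) (Suc j)
        \<le> (s (Suc j) - s j) * b i (Suc j) + (t (Suc i) - t i) * b (Suc i) j
          + (s (Suc j) - s j) * (E (Suc i) - E i) + (t (Suc i) - t i) * (F (Suc j) - F j)"
    and ij: "i \<le> K" "j \<le> L"
  shows "b i j \<le> D + E i + F j + Y * (c / 2 + ((t i - s j)\<^sup>2 + e * (t i + s j)) / (2 * c))"
proof -
  \<comment> \<open>The supersolution. On the axes it dominates \<open>b\<close> by
    \<open>amgm\<close>, since there the time difference and the sum of the times coincide; inside,
    it satisfies the recursion with the reverse inequality, so a double induction spreads the bound
    over the grid.\<close>
  define G where "G i j = D + E i + F j + Y * (c / 2 + ((t i - s j)\<^sup>2 + e * (t i + s j)) / (2 * c))"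
    for i j
  have amgm: "a * Y \<le> Y * (c / 2 + (a\<^sup>2 + e * a) / (2 * c))" if "0 \<le> a" for a
  proof -
    have "0 \<le> (a - c)\<^sup>2 + e * a" using that e by simp
    then have "2 * c * a \<le> c * c + a\<^sup>2 + e * a" by (simp add: power2_eq_square algebra_simps)
    then have "a \<le> c / 2 + (a\<^sup>2 + e * a) / (2 * c)" using c by (simp add: field_simps)
    then show ?thesis using Y by (metis mult.commute mult_left_mono)
  qed
  have tpos: "0 \<le> t i" if "i \<le> K" for i
    using that by (induction i) (use t in \<open>auto simp: Suc_le_eq\<close>, fastforce)
  have spos: "0 \<le> s j" if "j \<le> L" for j
    using that by (induction j) (use s in \<open>auto simp: Suc_le_eq\<close>, fastforce)
  have "b i j \<le> G i j" if "i \<le> K" "j \<le> L" for i j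
    using that
  proof (induction i arbitrary: j)
    case 0
    then show ?case
      using right[of j] amgm[OF spos[of j]] by (simp add: G_def t(1) EF)
  next
    case (Suc i)
    note outer = Suc
    from outer(3) show ?case
    proof (induction j)
      case 0
      then show ?case
        using left[of "Suc i"] amgm[OF tpos[of "Suc i"]] outer(2) by (simp add: G_def s(1) EF)
    next
      case (Suc j)
      define h where "h = t (Suc i) - t i"
      define k where "k = s (Suc j) - s j"
      define d where "d = t (Suc i) - s (Suc j)"
      define S where "S = t (Suc i) + s (Suc j)"
      have hk: "0 < h" "h \<le> e" "0 < k" "k \<le> e"
        using t(2,3)[of i] s(2,3)[of j] outer(2) Suc(2) by (auto simp: h_def k_def)
      \<comment> \<open>The terms linear in \<open>d\<close> cancel. The squares leave an excess
        \<open>h * k * (h + k)\<close>, which the decrease \<open>2 * e * h * k\<close> of the other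
        part covers because both steps are at most \<open>e\<close>.\<close>
      have "k * ((d - h)\<^sup>2 + e * (S - h)) + h * ((d + k)\<^sup>2 + e * (S - k))
          = (h + k) * (d\<^sup>2 + e * S) - h * k * ((e - h) + (e - k))"
        by (simp add: power2_eq_square algebra_simps)
      also have "\<dots> \<le> (h + k) * (d\<^sup>2 + e * S)"
        using hk by simp
      finally have quad: "(k * ((d - h)\<^sup>2 + e * (S - h)) + h * ((d + k)\<^sup>2 + e * (S - k))) / (2 * c)
          \<le> (h + k) * (d\<^sup>2 + e * S) / (2 * c)"
        using c by (simp add: divide_right_mono)
      have "(h + k) * b (Suc i) (Suc j) \<le> k * b i (Suc j) + h * b (Suc i) j
          + k * (E (Suc i) - E i) + h * (F (Suc j) - F j)"
        using step[of i j] outer(2) Suc(2) by (simp add: h_def k_def)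
      also have "\<dots> \<le> k * G i (Suc j) + h * G (Suc i) j
          + k * (E (Suc i) - E i) + h * (F (Suc j) - F j)"
        using outer(1)[of "Suc j"] outer(2) Suc hk by (intro add_mono mult_left_mono) auto
      also have "\<dots> = (h + k) * (D + E (Suc i) + F (Suc j)) + Y * ((h + k) * (c / 2)
          + (k * ((d - h)\<^sup>2 + e * (S - h)) + h * ((d + k)\<^sup>2 + e * (S - k))) / (2 * c))"
      proof -
        have *: "t i - s (Suc j) = d - h" "t i + s (Suc j) = S - h"
          "t (Suc i) - s j = d + k" "t (Suc i) + s j = S - k"
          by (simp_all add: d_def h_def k_def S_def)
        have "k * (D + E i + F (Suc j) + Y * (c / 2 + U / (2 * c)))
            + h * (D + E (Suc i) + F j + Y * (c / 2 + V / (2 * c)))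
            + k * (E (Suc i) - E i) + h * (F (Suc j) - F j)
          = (h + k) * (D + E (Suc i) + F (Suc j)) + Y * ((h + k) * (c / 2) + (k * U + h * V) / (2 * c))"
          for U V by (simp add: add_divide_distrib algebra_simps)
        then show ?thesis unfolding G_def * .
      qed
      also have "\<dots> \<le> (h + k) * (D + E (Suc i) + F (Suc j)) + Y * ((h + k) * (c / 2)
          + (h + k) * (d\<^sup>2 + e * S) / (2 * c))"
        using quad Y by (intro add_mono mult_left_mono order_refl) auto
      also have "\<dots> = (h + k) * G (Suc i) (Suc j)"
        unfolding G_def d_def[symmetric] S_def[symmetric] by (simp add: algebra_simps)
      finally show ?case using hk by simp
    qed
  qed
  then show ?thesis using ij by (simp add: G_def)
qed

text \<open>The inequality is put on \<open>A\<close> itself instead of on \<open>A\<close> shifted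
  by \<omega>. It can be asked for every \<open>l > 0\<close>, because for
  \<open>l * \<omega> \<ge> 1\<close> its left side is at most 0. The sign of \<omega> makes the
  later growth factors at least 1.\<close>

locale accretive_operator =
  fixes X :: "'a::real_vector set" and N :: "'a \<Rightarrow> real" and A :: "('a \<times> 'a) set" and \<omega> :: real
  assumes nsp: "normed_space_on X N"
    and operator: "A \<subseteq> X \<times> X"
    and omega_nonneg: "0 \<le> \<omega>"
    and acc: "\<And>x y x' y' l. (x, y) \<in> A \<Longrightarrow> (x', y') \<in> A \<Longrightarrow> 0 < l \<Longrightarrow>
      (1 - l * \<omega>) * N (x - x') \<le> N (x - x' + l *\<^sub>R (y - y'))"

lemma omega_accretiveD:
  assumes nsp: "normed_space_on X N" and A: "A \<subseteq> X \<times> X" and acc: "omega_accretive X N w A"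
    and w: "w \<le> \<omega>" and xy: "(x, y) \<in> A" "(x', y') \<in> A" and l: "0 < l"
  shows "(1 - l * \<omega>) * N (x - x') \<le> N (x - x' + l *\<^sub>R (y - y'))"
proof -
  note sub = normed_space_onD(1)[OF nsp]
  have X: "x \<in> X" "y \<in> X" "x' \<in> X" "y' \<in> X" using xy A by auto
  have pos: "0 \<le> N (x - x')" "0 \<le> N (x - x' + l *\<^sub>R (y - y'))"
    using X by (auto intro!: normed_space_on_nonneg[OF nsp] subspace_add subspace_diff subspace_scale sub)
  show ?thesis
  proof (cases "l * w < 1")
    case False
    then have "1 - l * \<omega> \<le> 0" using w l by (smt (verit) mult_left_mono)
    then show ?thesis using pos by (smt (verit) mult_nonpos_nonneg)
  next
    case True
    \<comment> \<open>The parameter at which accretivity of the shifted operator is used: after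
      multiplication by \<open>1 - l * w\<close> the coefficient of the operator values is
      \<open>l\<close>, and the terms with \<open>w\<close> cancel.\<close>
    define m where "m = l / (1 - l * w)"
    have m: "0 < m" "(1 - l * w) * m = l" using True l by (auto simp: m_def)
    have mem: "(x, y + w *\<^sub>R x) \<in> op_plus A (op_scale w (Id_on X))"
      "(x', y' + w *\<^sub>R x') \<in> op_plus A (op_scale w (Id_on X))"
      using xy X unfolding op_plus_def op_scale_def by auto
    have "N (x - x') \<le> N (x - x' + m *\<^sub>R ((y + w *\<^sub>R x) - (y' + w *\<^sub>R x')))"
      using acc mem m(1) unfolding omega_accretive_def accretive_def by blast
    also have "(1 - l * w) * \<dots> = N ((1 - l * w) *\<^sub>R (x - x' + m *\<^sub>R ((y + w *\<^sub>R x) - (y' + w *\<^sub>R x'))))"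
      using True X
      by (subst normed_space_onD(4)[OF nsp])
        (auto intro!: subspace_add subspace_diff subspace_scale sub)
    also have "(1 - l * w) *\<^sub>R (x - x' + m *\<^sub>R ((y + w *\<^sub>R x) - (y' + w *\<^sub>R x')))
        = (1 - l * w) *\<^sub>R (x - x') + ((1 - l * w) * m) *\<^sub>R ((y + w *\<^sub>R x) - (y' + w *\<^sub>R x'))"
      by (simp only: scaleR_add_right scaleR_scaleR)
    also have "\<dots> = x - x' + l *\<^sub>R (y - y')"
      unfolding m(2) by (simp add: algebra_simps)
    finally have "(1 - l * w) * N (x - x') \<le> N (x - x' + l *\<^sub>R (y - y'))"
      using True by (simp add: mult_left_mono)
    moreover have "(1 - l * \<omega>) * N (x - x') \<le> (1 - l * w) * N (x - x')"
      using w l pos(1) by (intro mult_right_mono) auto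
    ultimately show ?thesis by linarith
  qed
qed

lemma sum_steps_shift:
  fixes t f :: "nat \<Rightarrow> real"
  shows "(\<Sum>i=1..K. (t i - t (i - 1)) * f i) = (\<Sum>i<K. (t (Suc i) - t i) * f (Suc i))"
  by (rule sum.reindex_bij_witness[of _ Suc "\<lambda>i. i - 1"]) auto

context accretive_operator
begin

section \<open>Norm calculus inside the carrier, and the data of an approximate solution\<close>

lemma sub: "subspace X"
  using normed_space_onD(1)[OF nsp] .

lemma mem [simp, intro]: "x \<in> X \<Longrightarrow> y \<in> X \<Longrightarrow> x + y \<in> X"
  "x \<in> X \<Longrightarrow> y \<in> X \<Longrightarrow> x - y \<in> X" "x \<in> X \<Longrightarrow> a *\<^sub>R x \<in> X"
  using sub by (auto intro: subspace_add subspace_diff subspace_scale)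

lemma zero_mem [simp, intro]: "0 \<in> X"
  using sub by (rule subspace_0)

lemmas tri = normed_space_onD(3)[OF nsp]
lemmas N_scale = normed_space_onD(4)[OF nsp]
lemmas N_nonneg [simp, intro] = normed_space_on_nonneg[OF nsp]

lemma N_zero [simp]: "N 0 = 0"
  using normed_space_onD(2)[OF nsp, of 0] by simp

lemma N_commute: "x \<in> X \<Longrightarrow> y \<in> X \<Longrightarrow> N (x - y) = N (y - x)"
  using normed_space_on_minus[OF nsp, of "x - y"] by simp

lemma tri_diff: "x \<in> X \<Longrightarrow> y \<in> X \<Longrightarrow> N (x - y) \<le> N x + N y"
  using tri[of x "- y"] normed_space_on_minus[OF nsp, of y] mem(3)[of y "-1"] by simp

lemma tri_via: "x \<in> X \<Longrightarrow> y \<in> X \<Longrightarrow> p \<in> X \<Longrightarrow> N (x - y) \<le> N (x - p) + N (p - y)"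
  using tri[of "x - p" "p - y"] by simp

lemma approx_solutionD:
  assumes "approx_solution X N A x e T K t v \<theta>"
  shows "t 0 = 0" "\<And>i. i < K \<Longrightarrow> t i < t (Suc i)" "\<And>i. i < K \<Longrightarrow> t (Suc i) - t i \<le> e"
    "t K \<le> T" "T - e < t K"
    "\<And>i. i \<le> K \<Longrightarrow> v i \<in> X" "\<And>i. i \<le> K \<Longrightarrow> \<theta> i \<in> X" "N (v 0 - x) \<le> e"
    "\<And>i. i < K \<Longrightarrow>
      (v (Suc i), \<theta> (Suc i) - (v (Suc i) - v i) /\<^sub>R (t (Suc i) - t i)) \<in> A"
    "(\<Sum>i<K. (t (Suc i) - t i) * N (\<theta> (Suc i))) \<le> e"
proof -
  note * = assms[unfolded approx_solution_def discretization_def]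
  show "t 0 = 0" "t K \<le> T" "T - e < t K" "N (v 0 - x) \<le> e"
    "\<And>i. i \<le> K \<Longrightarrow> v i \<in> X" "\<And>i. i \<le> K \<Longrightarrow> \<theta> i \<in> X"
    using * by auto
  show "t i < t (Suc i)" "t (Suc i) - t i \<le> e" if "i < K" for i
    using * that by (auto dest!: bspec[of _ _ "Suc i"])
  show "(v (Suc i), \<theta> (Suc i) - (v (Suc i) - v i) /\<^sub>R (t (Suc i) - t i)) \<in> A" if "i < K" for i
  proof -
    have "\<exists>y\<in>A `` {v (Suc i)}. \<theta> (Suc i) = (v (Suc i) - v (Suc i - 1)) /\<^sub>R (t (Suc i) - t (Suc i - 1)) + y"
    proof -
      have "Suc i \<in> {1..K}" using that by simp
      then show ?thesis using * by blast
    qed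
    then show ?thesis by auto
  qed
  show "(\<Sum>i<K. (t (Suc i) - t i) * N (\<theta> (Suc i))) \<le> e" using * unfolding sum_steps_shift[of t] by simp
qed

lemma approx_solution_time_le:
  assumes "approx_solution X N A x e T K t v \<theta>" "i \<le> K"
  shows "t i \<le> T"
proof -
  note D = approx_solutionD[OF assms(1)]
  have "t i \<le> t K"
    using assms(2)
  proof (induction rule: inc_induct)
    case (step l)
    then show ?case using D(2)[of l] by linarith
  qed simp
  then show ?thesis using D(4) by simp
qed

lemma approx_solution_error_le:
  assumes "approx_solution X N A x e T K t v \<theta>" "i \<le> K"
  shows "(\<Sum>l<i. (t (Suc l) - t l) * N (\<theta> (Suc l))) \<le> e"
proof -
  note D = approx_solutionD[OF assms(1)]
  have "(\<Sum>l<i. (t (Suc l) - t l) * N (\<theta> (Suc l))) \<le> (\<Sum>l<K. (t (Suc l) - t l) * N (\<theta> (Suc l)))"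
  proof (rule sum_mono2)
    show "0 \<le> (t (Suc l) - t l) * N (\<theta> (Suc l))" if "l \<in> {..<K} - {..<i}" for l
      using D(2)[of l] D(7)[of "Suc l"] that by simp
  qed (use assms(2) in auto)
  then show ?thesis using D(10) by simp
qed

text \<open>Accretivity is applied with \<open>l = h * k / (h + k)\<close>. Then
  \<open>l / h\<close> and \<open>l / k\<close> add up to 1, so the two difference quotients turn
  \<open>v - w\<close> into the convex combination of \<open>v' - w\<close> and
  \<open>v - w'\<close> with weights \<open>k / (h + k)\<close> and
  \<open>h / (h + k)\<close>.\<close>

lemma grid_step:
  assumes h: "0 < h" "0 < k" and X: "v \<in> X" "v' \<in> X" "w \<in> X" "w' \<in> X" "p \<in> X" "q \<in> X"
    and A: "(v, p - (v - v') /\<^sub>R h) \<in> A" "(w, q - (w - w') /\<^sub>R k) \<in> A"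
  shows "(h + k - h * k * \<omega>) * N (v - w)
    \<le> k * N (v' - w) + h * N (v - w') + h * k * (N p + N q)"
proof -
  define l where "l = h * k / (h + k)"
  have hk: "0 < h + k" using h by simp
  have l: "0 < l" "(h + k) * l = h * k" using h by (auto simp: l_def)
  have l': "(h + k) * (1 - l * \<omega>) = h + k - h * k * \<omega>"
    using l(2) by (metis mult.assoc mult.right_neutral right_diff_distrib)
  have eq: "(h + k) *\<^sub>R (v - w + l *\<^sub>R ((p - (v - v') /\<^sub>R h) - (q - (w - w') /\<^sub>R k)))
     = k *\<^sub>R (v' - w) + h *\<^sub>R (v - w') + (h * k) *\<^sub>R (p - q)"
  proof -
    have "(h + k) *\<^sub>R (v - w + l *\<^sub>R ((p - (v - v') /\<^sub>R h) - (q - (w - w') /\<^sub>R k)))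
      = (h + k) *\<^sub>R (v - w) + ((h + k) * l) *\<^sub>R ((p - (v - v') /\<^sub>R h) - (q - (w - w') /\<^sub>R k))"
      by (simp only: scaleR_add_right scaleR_scaleR)
    also have "\<dots> = (h + k) *\<^sub>R (v - w) + (h * k) *\<^sub>R (p - q) - k *\<^sub>R (v - v') + h *\<^sub>R (w - w')"
      unfolding l(2) using h by (simp add: scaleR_diff_right scaleR_add_right field_simps)
    also have "\<dots> = k *\<^sub>R (v' - w) + h *\<^sub>R (v - w') + (h * k) *\<^sub>R (p - q)"
      by (simp add: algebra_simps)
    finally show ?thesis .
  qed
  have "(h + k - h * k * \<omega>) * N (v - w) = (h + k) * ((1 - l * \<omega>) * N (v - w))"
    using l' by simp
  also have "\<dots> \<le> (h + k) * N (v - w + l *\<^sub>R ((p - (v - v') /\<^sub>R h) - (q - (w - w') /\<^sub>R k)))"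
    using acc[OF A l(1)] hk by (intro mult_left_mono) auto
  also have "\<dots> = N (k *\<^sub>R (v' - w) + h *\<^sub>R (v - w') + (h * k) *\<^sub>R (p - q))"
    unfolding eq[symmetric] using hk X by (subst N_scale) (auto intro!: mem)
  also have "\<dots> \<le> N (k *\<^sub>R (v' - w) + h *\<^sub>R (v - w')) + N ((h * k) *\<^sub>R (p - q))"
    using X by (intro tri) auto
  also have "\<dots> \<le> N (k *\<^sub>R (v' - w)) + N (h *\<^sub>R (v - w')) + N ((h * k) *\<^sub>R (p - q))"
    using X by (intro add_mono tri) auto
  also have "\<dots> = k * N (v' - w) + h * N (v - w') + h * k * N (p - q)"
    using X h by (simp add: N_scale)
  also have "\<dots> \<le> k * N (v' - w) + h * N (v - w') + h * k * (N p + N q)"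
    using tri_diff[of p q] X h by (intro add_mono mult_left_mono) auto
  finally show ?thesis .
qed

text \<open>The analogue of \<open>grid_step\<close> with the second solution frozen at
  \<open>x\<close>. It supplies the values on the edges of the grid, where only one index
  moves.\<close>

lemma boundary_step:
  assumes h: "0 < h" and X: "v \<in> X" "v' \<in> X" "p \<in> X"
    and A: "(v, p - (v - v') /\<^sub>R h) \<in> A" "(x, y) \<in> A"
  shows "(1 - h * \<omega>) * N (v - x) \<le> N (v' - x) + h * (N p + N y)"
proof -
  have xy: "x \<in> X" "y \<in> X" using A operator by auto
  have "v - x + h *\<^sub>R ((p - (v - v') /\<^sub>R h) - y) = v' - x + h *\<^sub>R (p - y)"
    using h by (simp add: algebra_simps)
  then have "(1 - h * \<omega>) * N (v - x) \<le> N (v' - x + h *\<^sub>R (p - y))"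
    using acc[OF A h] by (simp only:)
  also have "\<dots> \<le> N (v' - x) + N (h *\<^sub>R (p - y))"
    using X xy by (intro tri) auto
  also have "\<dots> = N (v' - x) + h * N (p - y)" using X xy h by (simp add: N_scale)
  also have "\<dots> \<le> N (v' - x) + h * (N p + N y)"
    using tri_diff[of p y] X xy h by (intro add_mono mult_left_mono) auto
  finally show ?thesis .
qed

end

text \<open>\<open>P\<close> and \<open>Q\<close> are the growth factors before the step,
  \<open>P / p\<close> and \<open>Q / q\<close> those after it. With denominators cleared, the
  coefficient on the left is \<open>h * q + k * p\<close>, smaller by
  \<open>h * k * \<omega>\<close> than the one in \<open>main\<close>; this slack is dropped. In the
  error terms \<open>P * Q\<close> may be replaced by \<open>p * q\<close>, since
  \<open>p * q \<le> 1 \<le> P * Q\<close>.\<close>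

lemma discounted_step:
  fixes a a1 a2 h k p q P Q \<alpha> \<beta> \<omega> :: real
  assumes main: "(h + k - h * k * \<omega>) * a \<le> k * a1 + h * a2 + h * k * (\<alpha> + \<beta>)"
    and h: "0 < h" "0 < k" and \<omega>: "0 \<le> \<omega>" and p: "p = 1 - \<omega> * h" "0 < p" and q: "q = 1 - \<omega> * k" "0 < q"
    and PQ: "1 \<le> P" "1 \<le> Q" and nn: "0 \<le> a" "0 \<le> \<alpha>" "0 \<le> \<beta>"
  shows "(h / p + k / q) * (a / ((P / p) * (Q / q)))
    \<le> k / q * (a1 / (P * (Q / q))) + h / p * (a2 / ((P / p) * Q)) + k / q * (h / p * \<alpha>) + h / p * (k / q * \<beta>)"
proof -
  have le1: "p \<le> 1" "q \<le> 1" using p q h \<omega> by auto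
  have pq: "p * q \<le> P * Q"
    using le1 p(2) q(2) PQ by (intro mult_mono) auto
  have PQ0: "0 < P * Q" using PQ by simp
  have "h * q + k * p = h + k - h * k * \<omega> - h * k * \<omega>"
    unfolding p(1) q(1) by (simp add: algebra_simps)
  then have "(h * q + k * p) * a \<le> (h + k - h * k * \<omega>) * a"
    using h \<omega> nn(1) by (intro mult_right_mono) auto
  then have "(h * q + k * p) * a / (P * Q) \<le> (k * a1 + h * a2 + h * k * (\<alpha> + \<beta>)) / (P * Q)"
    using main PQ0 by (intro divide_right_mono) auto
  also have "\<dots> = (k * a1 + h * a2) / (P * Q) + h * k * (\<alpha> + \<beta>) / (P * Q)"
    by (simp add: add_divide_distrib)
  also have "\<dots> \<le> (k * a1 + h * a2) / (P * Q) + h * k * (\<alpha> + \<beta>) / (p * q)"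
    using pq p(2) q(2) PQ0 h nn by (intro add_left_mono divide_left_mono) auto
  finally have "(h * q + k * p) * a / (P * Q) \<le> (k * a1 + h * a2) / (P * Q) + h * k * (\<alpha> + \<beta>) / (p * q)" .
  moreover have "(h / p + k / q) * (a / ((P / p) * (Q / q))) = (h * q + k * p) * a / (P * Q)"
    using p(2) q(2) PQ by (simp add: field_simps)
  moreover have "k / q * (a1 / (P * (Q / q))) + h / p * (a2 / ((P / p) * Q)) = (k * a1 + h * a2) / (P * Q)"
    using p(2) q(2) PQ by (simp add: field_simps)
  moreover have "k / q * (h / p * \<alpha>) + h / p * (k / q * \<beta>) = h * k * (\<alpha> + \<beta>) / (p * q)"
    using p(2) q(2) by (simp add: field_simps)
  ultimately show ?thesis by linarith
qed

text \<open>Dividing distances by \<open>growth\<close> and enlarging each step \<open>h\<close> to \<open>h / (1 - \<omega> * h)\<close> turns the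
  inequality with \<open>\<omega>\<close> into the one with \<open>\<omega> = 0\<close>.\<close>

definition dilated_time :: "real \<Rightarrow> (nat \<Rightarrow> real) \<Rightarrow> nat \<Rightarrow> real" where
  "dilated_time \<omega> t i = (\<Sum>l<i. (t (Suc l) - t l) / (1 - \<omega> * (t (Suc l) - t l)))"

definition growth :: "real \<Rightarrow> (nat \<Rightarrow> real) \<Rightarrow> nat \<Rightarrow> real" where
  "growth \<omega> t i = (\<Prod>l<i. 1 / (1 - \<omega> * (t (Suc l) - t l)))"

definition weighted_error :: "real \<Rightarrow> (nat \<Rightarrow> real) \<Rightarrow> (nat \<Rightarrow> real) \<Rightarrow> nat \<Rightarrow> real" where
  "weighted_error \<omega> t \<alpha> i =
    (\<Sum>l<i. (t (Suc l) - t l) / (1 - \<omega> * (t (Suc l) - t l)) * \<alpha> (Suc l))"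

lemma discount_simps [simp]:
  "dilated_time \<omega> t 0 = 0"
  "dilated_time \<omega> t (Suc i) = dilated_time \<omega> t i + (t (Suc i) - t i) / (1 - \<omega> * (t (Suc i) - t i))"
  "growth \<omega> t 0 = 1"
  "growth \<omega> t (Suc i) = growth \<omega> t i / (1 - \<omega> * (t (Suc i) - t i))"
  "weighted_error \<omega> t \<alpha> 0 = 0"
  "weighted_error \<omega> t \<alpha> (Suc i) = weighted_error \<omega> t \<alpha> i
    + (t (Suc i) - t i) / (1 - \<omega> * (t (Suc i) - t i)) * \<alpha> (Suc i)"
  by (simp_all add: dilated_time_def growth_def weighted_error_def)

text \<open>The bound on \<open>2 * \<omega> * e\<close> keeps every denominator above 1/2. A
  dilated step gets two upper bounds: the factor 2 suffices for meshes and errors, while times need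
  the first-order bound, so that their distortion vanishes with \<open>e\<close>.\<close>

lemma step_discount:
  fixes \<omega> h e :: real
  assumes "0 \<le> \<omega>" "0 < h" "h \<le> e" "2 * \<omega> * e \<le> 1"
  shows "1 / 2 \<le> 1 - \<omega> * h" "1 - \<omega> * h \<le> 1" "h \<le> h / (1 - \<omega> * h)"
    "h / (1 - \<omega> * h) \<le> 2 * h" "h / (1 - \<omega> * h) \<le> h + 2 * \<omega> * e * h"
    "1 / (1 - \<omega> * h) \<le> exp (2 * \<omega> * h)"
proof -
  have wh: "\<omega> * h \<le> \<omega> * e" using assms by (intro mult_left_mono) auto
  then show half: "1 / 2 \<le> 1 - \<omega> * h" using assms by simp
  have wh0: "0 \<le> \<omega> * h" using assms by simp
  then show "1 - \<omega> * h \<le> 1" by simp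
  show "h \<le> h / (1 - \<omega> * h)" using half wh0 assms by (simp add: field_simps)
  have "1 / (1 - \<omega> * h) \<le> 1 / (1 / 2)" using half by (intro divide_left_mono) auto
  then have two: "1 / (1 - \<omega> * h) \<le> 2" by simp
  then show "h / (1 - \<omega> * h) \<le> 2 * h" using half assms by (simp add: field_simps)
  have "1 / (1 - \<omega> * h) = 1 + \<omega> * h * (1 / (1 - \<omega> * h))" using half by (simp add: field_simps)
  also have "\<dots> \<le> 1 + \<omega> * h * 2" using two wh0 by (intro add_mono mult_left_mono) auto
  finally have lin: "1 / (1 - \<omega> * h) \<le> 1 + 2 * (\<omega> * h)" by simp
  also have "\<dots> \<le> exp (2 * (\<omega> * h))" by (rule exp_ge_add_one_self)
  finally show "1 / (1 - \<omega> * h) \<le> exp (2 * \<omega> * h)" by (simp add: mult.assoc)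
  have "h * (1 / (1 - \<omega> * h)) \<le> h * (1 + 2 * (\<omega> * e))"
    using lin wh assms by (intro mult_left_mono) auto
  then show "h / (1 - \<omega> * h) \<le> h + 2 * \<omega> * e * h" by (simp add: algebra_simps)
qed

lemma discount_bounds:
  fixes t \<alpha> :: "nat \<Rightarrow> real"
  assumes t: "t 0 = 0" "\<And>i. i < K \<Longrightarrow> t i < t (Suc i)" "\<And>i. i < K \<Longrightarrow> t (Suc i) - t i \<le> e"
    and \<omega>: "0 \<le> \<omega>" "2 * \<omega> * e \<le> 1" and i: "i \<le> K" and \<alpha>: "\<And>i. i \<le> K \<Longrightarrow> 0 \<le> \<alpha> i"
  shows "0 \<le> t i" "t i \<le> dilated_time \<omega> t i" "dilated_time \<omega> t i \<le> 2 * t i"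
    "dilated_time \<omega> t i \<le> t i + 2 * \<omega> * e * t i"
    "1 \<le> growth \<omega> t i" "growth \<omega> t i \<le> exp (2 * \<omega> * t i)" "0 \<le> weighted_error \<omega> t \<alpha> i"
    "weighted_error \<omega> t \<alpha> i \<le> 2 * (\<Sum>l<i. (t (Suc l) - t l) * \<alpha> (Suc l))"
  using i
proof (induction i)
  case 0
  {
    case 1 show ?case using t(1) by simp
    case 2 show ?case using t(1) by simp
    case 3 show ?case using t(1) by simp
    case 4 show ?case using t(1) by simp
    case 5 show ?case using t(1) by simp
    case 6 show ?case using t(1) by simp
    case 7 show ?case by simp
    case 8 show ?case by simp
  }
next
  case (Suc i)
  define h where "h = t (Suc i) - t i"
  have tS: "t (Suc i) = t i + h" by (simp add: h_def)
  {
    assume i: "Suc i \<le> K"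
    have h: "0 < h" "h \<le> e" using t(2,3)[of i] i by (auto simp: h_def)
    note sd = step_discount[OF \<omega>(1) h \<omega>(2)]
    note IH = Suc.IH[OF Suc_leD[OF i]]
    have \<alpha>0: "0 \<le> \<alpha> (Suc i)" using \<alpha>[of "Suc i"] i by simp
    have "growth \<omega> t i * 1 \<le> growth \<omega> t i * (1 / (1 - \<omega> * h))"
      using sd(1,2) IH(5) by (intro mult_left_mono) (auto simp: field_simps)
    then have g1: "1 \<le> growth \<omega> t (Suc i)" using IH(5) by (simp add: tS)
    have "growth \<omega> t i * (1 / (1 - \<omega> * h)) \<le> exp (2 * \<omega> * t i) * exp (2 * \<omega> * h)"
      using sd IH(5,6) by (intro mult_mono) auto
    then have g2: "growth \<omega> t (Suc i) \<le> exp (2 * \<omega> * t (Suc i))"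
      by (simp add: tS exp_add[symmetric] algebra_simps)
    have "h / (1 - \<omega> * h) * \<alpha> (Suc i) \<le> 2 * h * \<alpha> (Suc i)"
      using sd(4) \<alpha>0 by (intro mult_right_mono) auto
    then have w: "weighted_error \<omega> t \<alpha> (Suc i) \<le> 2 * (\<Sum>l<Suc i. (t (Suc l) - t l) * \<alpha> (Suc l))"
      using IH(8) by (simp add: tS)
    have w0: "0 \<le> weighted_error \<omega> t \<alpha> (Suc i)"
      using IH(7) sd(1) h \<alpha>0 by (simp add: tS)
    have "0 \<le> t (Suc i)" "t (Suc i) \<le> dilated_time \<omega> t (Suc i)" "dilated_time \<omega> t (Suc i) \<le> 2 * t (Suc i)"
      "dilated_time \<omega> t (Suc i) \<le> t (Suc i) + 2 * \<omega> * e * t (Suc i)"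
      using IH(1-4) sd h by (simp_all add: tS algebra_simps)
    note this g1 g2 w0 w
  }
  note step = this
  {
    case 1 then show ?case by (rule step(1))
    case 2 then show ?case by (rule step(2))
    case 3 then show ?case by (rule step(3))
    case 4 then show ?case by (rule step(4))
    case 5 then show ?case by (rule step(5))
    case 6 then show ?case by (rule step(6))
    case 7 then show ?case by (rule step(7))
    case 8 then show ?case by (rule step(8))
  }
qed

context accretive_operator
begin

text \<open>The constant \<open>x\<close> behaves like a solution with residual \<open>y\<close>,
  which costs \<open>N y\<close> per unit of dilated time. In the induction the fresh contribution
  \<open>h * r\<close> can be moved under the growth factor, because that factor is at least 1 and
  \<open>h \<le> h / p\<close>.\<close>

lemma boundary_estimate:
  assumes as: "approx_solution X N A z e T K t v \<theta>" and e: "2 * \<omega> * e \<le> 1"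
    and xy: "(x, y) \<in> A" and i: "i \<le> K"
  shows "N (v i - x) \<le> growth \<omega> t i *
    (N (v 0 - x) + weighted_error \<omega> t (\<lambda>i. N (\<theta> i)) i + dilated_time \<omega> t i * N y)"
  using i
proof (induction i)
  case 0
  then show ?case by simp
next
  case (Suc i)
  note D = approx_solutionD[OF as]
  define h where "h = t (Suc i) - t i"
  define p where "p = 1 - \<omega> * h"
  define B where "B = N (v 0 - x) + weighted_error \<omega> t (\<lambda>i. N (\<theta> i)) i + dilated_time \<omega> t i * N y"
  define r where "r = N (\<theta> (Suc i)) + N y"
  have h: "0 < h" "h \<le> e" using D(2,3)[of i] Suc(2) by (auto simp: h_def)
  have p: "1 / 2 \<le> p" "p \<le> 1" using step_discount[OF omega_nonneg h e] by (auto simp: p_def)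
  have P: "1 \<le> growth \<omega> t i"
    using discount_bounds(5)[where \<alpha> = "\<lambda>_. 0", OF D(1-3) omega_nonneg e] Suc(2) by simp
  have X: "v i \<in> X" "v (Suc i) \<in> X" "\<theta> (Suc i) \<in> X" using D(6,7) Suc(2) by auto
  have r: "0 \<le> r" using X xy operator by (auto simp: r_def)
  have hp: "h \<le> h / p" using p h by (simp add: field_simps)
  have "p * N (v (Suc i) - x) \<le> N (v i - x) + h * r"
    using boundary_step[OF h(1) X(2,1,3) D(9)[OF Suc_le_lessD[OF Suc(2)], unfolded h_def[symmetric]] xy]
    by (simp add: p_def h_def r_def mult.commute)
  also have "\<dots> \<le> growth \<omega> t i * B + growth \<omega> t i * (h / p * r)"
  proof (intro add_mono)
    show "N (v i - x) \<le> growth \<omega> t i * B" using Suc unfolding B_def by simp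
    have "1 * (h * r) \<le> growth \<omega> t i * (h / p * r)"
      using P hp r h by (intro mult_mono) auto
    then show "h * r \<le> growth \<omega> t i * (h / p * r)" by simp
  qed
  finally have "N (v (Suc i) - x) \<le> growth \<omega> t i / p * (B + h / p * r)"
    using p by (simp add: field_simps)
  then show ?case
    by (simp add: h_def[symmetric] p_def[symmetric] B_def r_def algebra_simps)
qed

text \<open>Origin of the constants: \<open>6 * e\<close> is \<open>2 * e\<close> from the two
  initial values and \<open>2 * e\<close> from each weighted error; each dilated time is off by at
  most \<open>2 * \<omega> * e * T\<close>; \<open>8 * e * T\<close> is the dilated mesh
  \<open>2 * e\<close> times a sum of dilated times of at most \<open>4 * T\<close>; each growth
  factor is at most \<open>exp (2 * \<omega> * T)\<close>.\<close>

lemma approx_solutions_distance: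
  assumes as: "approx_solution X N A z e T K t v \<theta>" "approx_solution X N A z e T L s w \<zeta>"
    and e: "2 * \<omega> * e \<le> 1" and z: "z \<in> X"
    and xy: "(x, y) \<in> A" and c: "0 < c" and ij: "i \<le> K" "j \<le> L"
  shows "N (v i - w j) \<le> exp (4 * \<omega> * T) * (6 * e + 2 * N (z - x)
    + N y * (c / 2 + ((\<bar>t i - s j\<bar> + 4 * \<omega> * e * T)\<^sup>2 + 8 * e * T) / (2 * c)))"
proof -
  note V = approx_solutionD[OF as(1)] and W = approx_solutionD[OF as(2)]
  have e0: "0 \<le> e" using V(6,8) z by (meson N_nonneg dual_order.trans le0 mem(2))
  have x: "x \<in> X" "y \<in> X" using xy operator by auto
  define \<alpha> where "\<alpha> i = N (\<theta> i)" for i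
  define \<beta> where "\<beta> j = N (\<zeta> j)" for j
  have nn: "0 \<le> \<alpha> i" if "i \<le> K" for i using V(7) that by (auto simp: \<alpha>_def)
  have nn': "0 \<le> \<beta> j" if "j \<le> L" for j using W(7) that by (auto simp: \<beta>_def)
  define P where "P = growth \<omega> t"
  define Q where "Q = growth \<omega> s"
  define E where "E = weighted_error \<omega> t \<alpha>"
  define F where "F = weighted_error \<omega> s \<beta>"
  define t' where "t' = dilated_time \<omega> t"
  define s' where "s' = dilated_time \<omega> s"
  define D where "D = N (v 0 - x) + N (w 0 - x)"
  have dt: "0 \<le> t i" "t i \<le> t' i" "t' i \<le> 2 * t i" "t' i \<le> t i + 2 * \<omega> * e * t i" "1 \<le> P i"
    "P i \<le> exp (2 * \<omega> * t i)" "0 \<le> E i" "E i \<le> 2 * (\<Sum>l<i. (t (Suc l) - t l) * \<alpha> (Suc l))"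
    if "i \<le> K" for i
    using discount_bounds[OF V(1-3) omega_nonneg e that nn] by (auto simp: t'_def P_def E_def)
  have ds: "0 \<le> s j" "s j \<le> s' j" "s' j \<le> 2 * s j" "s' j \<le> s j + 2 * \<omega> * e * s j" "1 \<le> Q j"
    "Q j \<le> exp (2 * \<omega> * s j)" "0 \<le> F j" "F j \<le> 2 * (\<Sum>l<j. (s (Suc l) - s l) * \<beta> (Suc l))"
    if "j \<le> L" for j
    using discount_bounds[OF W(1-3) omega_nonneg e that nn'] by (auto simp: s'_def Q_def F_def)
  note sdt = step_discount[OF omega_nonneg _ V(3) e] and sds = step_discount[OF omega_nonneg _ W(3) e]
  have est: "N (v i - w j) / (P i * Q j)
      \<le> D + E i + F j + N y * (c / 2 + ((t' i - s' j)\<^sup>2 + 2 * e * (t' i + s' j)) / (2 * c))"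
  \<comment> \<open>The recursion runs on the dilated grids, so its mesh parameter is
    \<open>2 * e\<close>, and on the distances divided by both growth factors.\<close>
  proof (rule kobayashi_recursion[where K = K and L = L and b = "\<lambda>i j. N (v i - w j) / (P i * Q j)"])
    show "t' 0 = 0" "s' 0 = 0" "E 0 = 0" "F 0 = 0"
      by (simp_all add: t'_def s'_def E_def F_def)
    show "t' i < t' (Suc i)" "t' (Suc i) - t' i \<le> 2 * e" if "i < K" for i
      using sdt[of i] V(2,3)[of i] that by (auto simp: t'_def)
    show "s' j < s' (Suc j)" "s' (Suc j) - s' j \<le> 2 * e" if "j < L" for j
      using sds[of j] W(2,3)[of j] that by (auto simp: s'_def)
    show "0 \<le> 2 * e" "0 < c" "0 \<le> N y" "i \<le> K" "j \<le> L" using e0 c x ij by auto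
    show "N (v i - w 0) / (P i * Q 0) \<le> D + E i + t' i * N y" if i: "i \<le> K" for i
    proof -
      have "N (v i - w 0) \<le> N (v i - x) + N (x - w 0)"
        using V(6)[OF i] W(6)[of 0] x by (intro tri_via) auto
      also have "\<dots> = N (v i - x) + 1 * N (w 0 - x)"
        using W(6)[of 0] x by (simp add: N_commute)
      also have "\<dots> \<le> P i * (N (v 0 - x) + E i + t' i * N y) + P i * N (w 0 - x)"
        using boundary_estimate[OF as(1) e xy i] dt(5)[OF i] W(6)[of 0] x
        by (intro add_mono mult_right_mono) (auto simp: P_def E_def t'_def \<alpha>_def[abs_def])
      finally have "N (v i - w 0) \<le> P i * (D + E i + t' i * N y)"
        by (simp add: D_def algebra_simps)
      then show ?thesis using dt(5)[OF i] by (simp add: Q_def field_simps)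
    qed
    show "N (v 0 - w j) / (P 0 * Q j) \<le> D + F j + s' j * N y" if j: "j \<le> L" for j
    proof -
      have "N (v 0 - w j) \<le> N (v 0 - x) + N (x - w j)"
        using W(6)[OF j] V(6)[of 0] x by (intro tri_via) auto
      also have "\<dots> = N (w j - x) + 1 * N (v 0 - x)"
        using W(6)[OF j] x by (simp add: N_commute)
      also have "\<dots> \<le> Q j * (N (w 0 - x) + F j + s' j * N y) + Q j * N (v 0 - x)"
        using boundary_estimate[OF as(2) e xy j] ds(5)[OF j] V(6)[of 0] x
        by (intro add_mono mult_right_mono) (auto simp: Q_def F_def s'_def \<beta>_def[abs_def])
      finally have "N (v 0 - w j) \<le> Q j * (D + F j + s' j * N y)"
        by (simp add: D_def algebra_simps)
      then show ?thesis using ds(5)[OF j] by (simp add: P_def field_simps)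
    qed
    fix i j assume i: "i < K" and j: "j < L"
    define h where "h = t (Suc i) - t i"
    define k where "k = s (Suc j) - s j"
    have hk: "0 < h" "0 < k" using V(2)[OF i] W(2)[OF j] by (auto simp: h_def k_def)
    have pq: "0 < 1 - \<omega> * h" "0 < 1 - \<omega> * k"
      using sdt(1)[of i] sds(1)[of j] hk i j by (auto simp: h_def k_def)
    have "(h + k - h * k * \<omega>) * N (v (Suc i) - w (Suc j))
        \<le> k * N (v i - w (Suc j)) + h * N (v (Suc i) - w j) + h * k * (\<alpha> (Suc i) + \<beta> (Suc j))"
      unfolding \<alpha>_def \<beta>_def using V(6,7) W(6,7) V(9)[OF i] W(9)[OF j] hk i j
      by (intro grid_step) (auto simp: h_def k_def)
    from discounted_step[OF this hk omega_nonneg refl pq(1) refl pq(2) dt(5)[of i] ds(5)[of j]]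
    show "(t' (Suc i) - t' i + (s' (Suc j) - s' j)) * (N (v (Suc i) - w (Suc j)) / (P (Suc i) * Q (Suc j)))
        \<le> (s' (Suc j) - s' j) * (N (v i - w (Suc j)) / (P i * Q (Suc j)))
          + (t' (Suc i) - t' i) * (N (v (Suc i) - w j) / (P (Suc i) * Q j))
          + (s' (Suc j) - s' j) * (E (Suc i) - E i) + (t' (Suc i) - t' i) * (F (Suc j) - F j)"
      using i j nn[of "Suc i"] nn'[of "Suc j"] V(6)[of "Suc i"] W(6)[of "Suc j"]
      by (simp add: t'_def s'_def P_def Q_def E_def F_def h_def k_def)
  qed
  define S where "S = 6 * e + 2 * N (z - x)
    + N y * (c / 2 + ((\<bar>t i - s j\<bar> + 4 * \<omega> * e * T)\<^sup>2 + 8 * e * T) / (2 * c))"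
  have tT: "t i \<le> T" and sT: "s j \<le> T"
    using approx_solution_time_le[OF as(1) ij(1)] approx_solution_time_le[OF as(2) ij(2)] .
  have eE: "E i \<le> 2 * e"
    using dt(8)[OF ij(1)] approx_solution_error_le[OF as(1) ij(1)] by (simp add: \<alpha>_def)
  have eF: "F j \<le> 2 * e"
    using ds(8)[OF ij(2)] approx_solution_error_le[OF as(2) ij(2)] by (simp add: \<beta>_def)
  have "D \<le> 2 * e + 2 * N (z - x)"
    using tri_via[of "v 0" x z] tri_via[of "w 0" x z] V(6)[of 0] W(6)[of 0] V(8) W(8) x z
    by (auto simp: D_def)
  then have DEF: "D + E i + F j \<le> 6 * e + 2 * N (z - x)" using eE eF by simp
  have sq: "(t' i - s' j)\<^sup>2 \<le> (\<bar>t i - s j\<bar> + 4 * \<omega> * e * T)\<^sup>2"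
  proof -
    have "\<omega> * e * t i \<le> \<omega> * e * T" "\<omega> * e * s j \<le> \<omega> * e * T"
      using tT sT omega_nonneg e0 by (auto intro!: mult_left_mono)
    then have "\<bar>t' i - s' j\<bar> \<le> \<bar>t i - s j\<bar> + 4 * \<omega> * e * T"
      using dt(2,4)[OF ij(1)] ds(2,4)[OF ij(2)] by linarith
    then have "\<bar>t' i - s' j\<bar>\<^sup>2 \<le> (\<bar>t i - s j\<bar> + 4 * \<omega> * e * T)\<^sup>2"
      by (intro power_mono) auto
    then show ?thesis by simp
  qed
  have "2 * e * (t' i + s' j) \<le> 8 * e * T"
    using mult_left_mono[of "t' i + s' j" "4 * T" "2 * e"] dt(3)[OF ij(1)] ds(3)[OF ij(2)] tT sT e0 by simp
  with sq have "(t' i - s' j)\<^sup>2 + 2 * e * (t' i + s' j)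
      \<le> (\<bar>t i - s j\<bar> + 4 * \<omega> * e * T)\<^sup>2 + 8 * e * T"
    by (rule add_mono)
  with DEF have "D + E i + F j + N y * (c / 2 + ((t' i - s' j)\<^sup>2 + 2 * e * (t' i + s' j)) / (2 * c)) \<le> S"
    unfolding S_def using c x
    by (intro add_mono[OF DEF] mult_left_mono add_left_mono divide_right_mono) auto
  with est have "N (v i - w j) / (P i * Q j) \<le> S" by simp
  then have "N (v i - w j) \<le> P i * Q j * S"
    using dt(5)[OF ij(1)] ds(5)[OF ij(2)] by (simp add: field_simps)
  also have "\<dots> \<le> exp (4 * \<omega> * T) * S"
  proof (rule mult_right_mono)
    have "P i * Q j \<le> exp (2 * \<omega> * T) * exp (2 * \<omega> * T)"
    proof (rule mult_mono)
      show "P i \<le> exp (2 * \<omega> * T)" "Q j \<le> exp (2 * \<omega> * T)"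
        using mult_left_mono[OF tT, of "2 * \<omega>"] mult_left_mono[OF sT, of "2 * \<omega>"] omega_nonneg
        by (auto intro: order_trans[OF dt(6)[OF ij(1)]] order_trans[OF ds(6)[OF ij(2)]])
    qed (use ds(5)[OF ij(2)] in auto)
    then show "P i * Q j \<le> exp (4 * \<omega> * T)" by (simp add: exp_add[symmetric] mult_ac)
    show "0 \<le> S"
      using dt(1)[OF ij(1)] tT e0 c x z omega_nonneg unfolding S_def
      by (intro add_nonneg_nonneg mult_nonneg_nonneg divide_nonneg_nonneg) auto
  qed
  finally show ?thesis unfolding S_def .
qed

end

section \<open>Uniqueness of mild solutions\<close>

text \<open>One \<open>d\<close> bounds both the errors and the time gap. With equal solutions this
  is a discrete modulus of continuity, with different ones a Cauchy property.\<close>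

definition approx_close ::
    "'a::real_vector set \<Rightarrow> ('a \<Rightarrow> real) \<Rightarrow> ('a \<times> 'a) set \<Rightarrow> 'a \<Rightarrow> real \<Rightarrow> real \<Rightarrow> real \<Rightarrow> bool" where
  "approx_close X N A z T \<eta> d \<longleftrightarrow>
    (\<forall>K t v \<theta> L s w \<zeta> i j.
      approx_solution X N A z d T K t v \<theta> \<and> approx_solution X N A z d T L s w \<zeta> \<and>
      i \<le> K \<and> j \<le> L \<and> \<bar>t i - s j\<bar> \<le> d \<longrightarrow> N (v i - w j) \<le> \<eta>)"

lemma approx_solution_mono:
  assumes "approx_solution X N A x e T K t v \<theta>" "e \<le> e'"
  shows "approx_solution X N A x e' T K t v \<theta>"
  using assms unfolding approx_solution_def discretization_def by fastforce

lemma approx_closeD: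
  assumes "approx_close X N A z T \<eta> d"
    and "approx_solution X N A z e T K t v \<theta>" "approx_solution X N A z e' T L s w \<zeta>"
    and "e \<le> d" "e' \<le> d" "i \<le> K" "j \<le> L" "\<bar>t i - s j\<bar> \<le> d"
  shows "N (v i - w j) \<le> \<eta>"
  using assms(1) approx_solution_mono[OF assms(2,4)] approx_solution_mono[OF assms(3,5)] assms(6-)
  unfolding approx_close_def by blast

text \<open>The thresholds depend on the operator only through \<open>\<omega>\<close> and \<open>Y\<close>, which is what makes the
  closeness uniform along a sequence of operators.\<close>

lemma approx_close_uniform:
  fixes \<omega> T \<eta> :: real
  assumes "0 \<le> \<omega>" "0 \<le> T" "0 < \<eta>"
  obtains r where "0 < r"
    "\<And>Y. \<exists>d>0. \<forall>(X::'a::real_vector set) N A z x y. accretive_operator X N A \<omega> \<longrightarrow> z \<in> X \<longrightarrow>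
      (x, y) \<in> A \<longrightarrow> N (z - x) \<le> r \<longrightarrow> N y \<le> Y \<longrightarrow> approx_close X N A z T \<eta> d"
proof
  define M where "M = exp (4 * \<omega> * T)"
  have M: "0 < M" by (simp add: M_def)
  \<comment> \<open>The tolerance is split: a quarter for the distance from \<open>z\<close> to
    \<open>x\<close>, a quarter for the term \<open>c / 2\<close>, and half for \<open>f d\<close>.
    The radius must not depend on \<open>Y\<close>, which is known only after \<open>x\<close> has
    been chosen within \<open>r\<close> of \<open>z\<close>.\<close>
  define r where "r = \<eta> / (8 * M)"
  show "0 < r" using M assms by (simp add: r_def)
  have r: "M * (2 * r) = \<eta> / 4" using M by (simp add: r_def)
  fix Y0 :: real
  \<comment> \<open>The maximum keeps \<open>Y\<close> positive, so that \<open>c\<close> can be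
    defined by dividing by it.\<close>
  define Y where "Y = max Y0 1"
  have Y: "0 < Y" "Y0 \<le> Y" by (auto simp: Y_def)
  define c where "c = \<eta> / (2 * M * Y)"
  have c: "0 < c" "M * (Y * (c / 2)) = \<eta> / 4" using M Y assms by (auto simp: c_def)
  \<comment> \<open>All that vanishes with \<open>d\<close> once \<open>c\<close> is fixed;
    continuity at 0 then yields a suitable \<open>d\<close>.\<close>
  define f where "f d = M * (6 * d + Y * ((d + 4 * \<omega> * d * T)\<^sup>2 + 8 * d * T) / (2 * c))" for d
  have "(f \<longlongrightarrow> f 0) (at_right 0)"
    unfolding f_def using c(1) by (intro tendsto_intros) auto
  moreover have "f 0 < \<eta> / 2" using assms by (simp add: f_def)
  ultimately have "\<forall>\<^sub>F d in at_right 0. f d < \<eta> / 2" by (rule order_tendstoD)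
  moreover have "\<forall>\<^sub>F d in at_right 0. 2 * \<omega> * d < 1"
    by (rule order_tendstoD(2)[where y = "2 * \<omega> * 0"]) (intro tendsto_intros, simp)
  moreover have "\<forall>\<^sub>F d in at_right 0. (0::real) < d" by (rule eventually_at_right_less)
  ultimately have "\<forall>\<^sub>F d in at_right 0. f d < \<eta> / 2 \<and> 2 * \<omega> * d < 1 \<and> 0 < d"
    by eventually_elim auto
  then obtain d where d: "f d < \<eta> / 2" "2 * \<omega> * d < 1" "0 < d"
    using eventually_happens' trivial_limit_at_right_real by blast
  show "\<exists>d>0. \<forall>(X::'a set) N A z x y. accretive_operator X N A \<omega> \<longrightarrow> z \<in> X \<longrightarrow>
      (x, y) \<in> A \<longrightarrow> N (z - x) \<le> r \<longrightarrow> N y \<le> Y0 \<longrightarrow> approx_close X N A z T \<eta> d"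
  proof (intro exI[of _ d] conjI d(3) allI impI)
    fix X :: "'a set" and N A z x y
    assume "accretive_operator X N A \<omega>" and z: "z \<in> X" and xy: "(x, y) \<in> A"
      and zx: "N (z - x) \<le> r" and y: "N y \<le> Y0"
    then interpret accretive_operator X N A \<omega> by simp
    show "approx_close X N A z T \<eta> d"
      unfolding approx_close_def
    proof (intro allI impI, elim conjE)
      fix K t v \<theta> L s w \<zeta> i j
      assume as: "approx_solution X N A z d T K t v \<theta>" "approx_solution X N A z d T L s w \<zeta>"
        and ij: "i \<le> K" "j \<le> L" and ts: "\<bar>t i - s j\<bar> \<le> d"
      have "N (v i - w j) \<le> M * (6 * d + 2 * N (z - x)
          + N y * (c / 2 + ((\<bar>t i - s j\<bar> + 4 * \<omega> * d * T)\<^sup>2 + 8 * d * T) / (2 * c)))"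
        unfolding M_def using d(2) by (intro approx_solutions_distance[OF as _ z xy c(1) ij]) simp
      also have "\<dots> \<le> M * (6 * d + 2 * r + Y * (c / 2 + ((d + 4 * \<omega> * d * T)\<^sup>2 + 8 * d * T) / (2 * c)))"
      proof (rule mult_left_mono)
        have "c / 2 + ((\<bar>t i - s j\<bar> + 4 * \<omega> * d * T)\<^sup>2 + 8 * d * T) / (2 * c)
            \<le> c / 2 + ((d + 4 * \<omega> * d * T)\<^sup>2 + 8 * d * T) / (2 * c)"
          using c(1) ts d(3) assms
          by (intro add_left_mono add_right_mono divide_right_mono power_mono add_nonneg_nonneg) auto
        then have "N y * (c / 2 + ((\<bar>t i - s j\<bar> + 4 * \<omega> * d * T)\<^sup>2 + 8 * d * T) / (2 * c))
            \<le> Y * (c / 2 + ((d + 4 * \<omega> * d * T)\<^sup>2 + 8 * d * T) / (2 * c))"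
          using y Y c(1) d(3) assms
          by (intro mult_mono add_nonneg_nonneg divide_nonneg_nonneg) auto
        then show "6 * d + 2 * N (z - x)
          + N y * (c / 2 + ((\<bar>t i - s j\<bar> + 4 * \<omega> * d * T)\<^sup>2 + 8 * d * T) / (2 * c))
          \<le> 6 * d + 2 * r + Y * (c / 2 + ((d + 4 * \<omega> * d * T)\<^sup>2 + 8 * d * T) / (2 * c))"
          using zx by linarith
      qed (use M in simp)
      also have "\<dots> = M * (2 * r) + M * (Y * (c / 2)) + f d"
        by (simp add: f_def algebra_simps)
      also have "\<dots> \<le> \<eta>" using d(1) r c(2) by simp
      finally show "N (v i - w j) \<le> \<eta>" .
    qed
  qed
qed

context accretive_operator
begin

section \<open>Closure of the domain and continuity in terms of the norm\<close>

abbreviation "dom_closure \<equiv> norm_topology X N closure_of Domain A"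

lemma closure_iff: "z \<in> dom_closure \<longleftrightarrow> z \<in> X \<and> (\<forall>r>0. \<exists>(x, y)\<in>A. N (z - x) < r)"
proof -
  interpret Metric_space X "norm_dist X N" by (rule Metric_space_norm_dist[OF nsp])
  show ?thesis
    unfolding norm_topology_def metric_closure_of using operator
    by (fastforce simp: norm_dist_def in_mball)
qed

lemma Domain_subset_closure: "(x, y) \<in> A \<Longrightarrow> x \<in> dom_closure"
  unfolding closure_iff using operator by force

lemma approx_close_exists:
  assumes "z \<in> dom_closure" "0 \<le> T" "0 < \<eta>"
  obtains d where "0 < d" "approx_close X N A z T \<eta> d"
proof -
  obtain r where r: "0 < r" "\<And>Y. \<exists>d>0. \<forall>(X::'a set) N A z x y. accretive_operator X N A \<omega> \<longrightarrow> z \<in> X \<longrightarrow>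
      (x, y) \<in> A \<longrightarrow> N (z - x) \<le> r \<longrightarrow> N y \<le> Y \<longrightarrow> approx_close X N A z T \<eta> d"
    using approx_close_uniform[OF omega_nonneg assms(2,3)] by metis
  obtain x y where xy: "(x, y) \<in> A" "N (z - x) < r" "z \<in> X"
    using assms(1) r(1) unfolding closure_iff by blast
  then show thesis
    using r(2)[of "N y"] that accretive_operator_axioms by (meson less_imp_le order_refl)
qed

lemma continuous_map_norm_iff:
  fixes u :: "real \<Rightarrow> 'a"
  shows "continuous_map (top_of_set S) (norm_topology X N) u \<longleftrightarrow>
    (\<forall>s\<in>S. u s \<in> X \<and> (\<forall>e>0. \<exists>d>0. \<forall>s'\<in>S. \<bar>s' - s\<bar> < d \<longrightarrow> u s' \<in> X \<and> N (u s - u s') < e))"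
    (is "?L \<longleftrightarrow> ?R")
proof -
  interpret Metric_space X "norm_dist X N" by (rule Metric_space_norm_dist[OF nsp])
  have eq: "u s' \<in> mball (u s) e \<longleftrightarrow> u s \<in> X \<and> u s' \<in> X \<and> N (u s - u s') < e" for s s' e
    by (auto simp: norm_dist_def in_mball)
  show ?thesis
  proof
    assume L: ?L
    show ?R
    proof (intro ballI conjI allI impI)
      fix s assume s: "s \<in> S"
      show "u s \<in> X" using L s unfolding norm_topology_def continuous_map_def by auto
      fix e :: real assume "0 < e"
      then obtain U where U: "openin (top_of_set S) U" "s \<in> U" "\<forall>y\<in>U. u y \<in> mball (u s) e"
        using L s unfolding norm_topology_def continuous_map_to_metric by force
      then obtain d where "0 < d" "\<forall>s'\<in>S. dist s' s < d \<longrightarrow> s' \<in> U"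
        unfolding openin_euclidean_subtopology_iff by blast
      then show "\<exists>d>0. \<forall>s'\<in>S. \<bar>s' - s\<bar> < d \<longrightarrow> u s' \<in> X \<and> N (u s - u s') < e"
        using U(3) unfolding eq by (auto simp: dist_real_def)
    qed
  next
    assume R: ?R
    show ?L
      unfolding norm_topology_def continuous_map_to_metric
    proof (intro ballI allI impI)
      fix s and e :: real assume "s \<in> topspace (top_of_set S)" and e: "0 < e"
      then have s: "s \<in> S" by simp
      obtain d where d: "u s \<in> X" "0 < d" "\<forall>s'\<in>S. \<bar>s' - s\<bar> < d \<longrightarrow> u s' \<in> X \<and> N (u s - u s') < e"
        using R[rule_format, OF s] e by blast
      show "\<exists>U. openin (top_of_set S) U \<and> s \<in> U \<and> (\<forall>y\<in>U. u y \<in> mball (u s) e)"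
        using s d by (intro exI[of _ "S \<inter> ball s d"]) (auto simp: eq dist_real_def abs_minus_commute simp del: in_mball)
    qed
  qed
qed

lemma mild_solution_onD:
  assumes "mild_solution_on X N A z T u"
  shows "u 0 = z" "\<And>s. s \<in> {0..T} \<Longrightarrow> u s \<in> X"
  using assms unfolding mild_solution_on_def continuous_map_norm_iff by auto

end

text \<open>The index depends on the grid and on \<open>s\<close> only, not on the node values. Past
  the last node the gap is controlled by \<open>T - e < t K\<close>.\<close>

lemma step_interp_index:
  assumes disc: "discretization e T K t" and s: "s \<in> {0..T}" and e: "0 \<le> e"
  obtains i where "i \<le> K" "\<bar>s - t i\<bar> \<le> e" "\<And>v. step_interp K t v s = v i"
proof -
  note D = disc[unfolded discretization_def]
  show thesis
  proof (cases "s \<le> t K")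
    case False
    show thesis
      by (rule that[of K]) (use False D s in \<open>auto simp: step_interp_def\<close>)
  next
    case True
    define i where "i = (LEAST i. s \<le> t i)"
    have i: "s \<le> t i" "i \<le> K"
      unfolding i_def by (rule LeastI[of _ K], rule True) (rule Least_le, rule True)
    have "\<bar>s - t i\<bar> \<le> e"
    proof (cases i)
      case 0
      then show ?thesis using i D s e by auto
    next
      case (Suc l)
      then have "\<not> s \<le> t l" using not_less_Least[of l "\<lambda>i. s \<le> t i"] unfolding i_def[symmetric] by simp
      moreover have "t (Suc l) - t l \<le> e" using D i(2) Suc by (auto dest!: bspec[of _ _ "Suc l"])
      ultimately show ?thesis using i(1) Suc by simp
    qed
    then show thesis using i(2) True by (intro that[of i]) (auto simp: step_interp_def i_def)
  qed
qed

context accretive_operator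
begin

text \<open>An approximate solution that certifies \<open>u\<close> with error at most
  \<open>d / 2\<close> has a node within \<open>d / 2\<close> of \<open>s\<close>; together with the
  gap between \<open>s\<close> and \<open>t i\<close> this stays within \<open>d\<close>, so
  closeness applies. No assumption on how \<open>u\<close> was constructed enters, so the lemma
  serves uniqueness as well as convergence.\<close>

lemma mild_solution_near_approx:
  assumes u: "mild_solution_on X N A z T u" and d: "0 < d" "0 < \<eta>" "approx_close X N A z T \<eta> d" and z: "z \<in> X"
    and as: "approx_solution X N A z e T K t v \<theta>" "e \<le> d" and i: "i \<le> K"
    and s: "s \<in> {0..T}" "\<bar>s - t i\<bar> \<le> d / 2"
  shows "N (u s - v i) \<le> 2 * \<eta>"
proof -
  define e' where "e' = min (d / 2) \<eta>"
  have e': "0 < e'" "e' \<le> d / 2" "e' \<le> \<eta>" "e' \<le> d" using d by (auto simp: e'_def)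
  then obtain L r w \<zeta> where w: "approx_solution X N A z e' T L r w \<zeta>"
    "\<forall>s\<in>{0..T}. N (u s - step_interp L r w s) \<le> e'"
    using u unfolding mild_solution_on_def by blast
  have disc: "discretization e' T L r" using w(1) by (simp add: approx_solution_def)
  obtain j where j: "j \<le> L" "\<bar>s - r j\<bar> \<le> e'" "\<And>v::nat \<Rightarrow> 'a. step_interp L r v s = v j"
    using step_interp_index[OF disc s(1) less_imp_le[OF e'(1)]] by metis
  have "N (u s - v i) \<le> N (u s - w j) + N (w j - v i)"
    using mild_solution_onD(2)[OF u s(1)] approx_solutionD(6)[OF as(1) i] approx_solutionD(6)[OF w(1) j(1)]
    by (intro tri_via)
  moreover have "N (u s - w j) \<le> \<eta>" using w(2) s(1) e'(3) j(3)[of w] by force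
  moreover have "N (w j - v i) \<le> \<eta>"
    using approx_closeD[OF d(3) w(1) as(1) e'(4) as(2) j(1) i] j(2) s(2) e'(2) by linarith
  ultimately show ?thesis by simp
qed

text \<open>The approximate solution that certifies \<open>u'\<close> belongs to the same initial
  value problem, so \<open>mild_solution_near_approx\<close> also places it near
  \<open>u\<close>.\<close>

lemma mild_solution_on_unique:
  assumes u: "mild_solution_on X N A z T u" "mild_solution_on X N A z T u'"
    and z: "z \<in> dom_closure" and s: "s \<in> {0..T}"
  shows "u s = u' s"
proof -
  have zX: "z \<in> X" using z closure_iff by blast
  note X = mild_solution_onD(2)[OF u(1) s] mild_solution_onD(2)[OF u(2) s]
  have "N (u s - u' s) \<le> 0 + \<eta>" if "0 < \<eta>" for \<eta>
  proof -
    obtain d where d: "0 < d" "approx_close X N A z T (\<eta> / 3) d"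
      using approx_close_exists[OF z, of T "\<eta> / 3"] s \<open>0 < \<eta>\<close> by auto
    define e where "e = min (d / 2) (\<eta> / 3)"
    have e: "0 < e" "e \<le> d / 2" "e \<le> \<eta> / 3" "e \<le> d" using d that by (auto simp: e_def)
    then obtain L r w \<zeta> where w: "approx_solution X N A z e T L r w \<zeta>"
      "\<forall>s\<in>{0..T}. N (u' s - step_interp L r w s) \<le> e"
      using u(2) unfolding mild_solution_on_def by blast
    have disc: "discretization e T L r" using w(1) by (simp add: approx_solution_def)
    obtain j where j: "j \<le> L" "\<bar>s - r j\<bar> \<le> e" "\<And>v::nat \<Rightarrow> 'a. step_interp L r v s = v j"
      using step_interp_index[OF disc s(1) less_imp_le[OF e(1)]] by metis
    have wX: "w j \<in> X" using approx_solutionD(6)[OF w(1) j(1)] .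
    have "N (u s - w j) \<le> 2 * (\<eta> / 3)"
      by (rule mild_solution_near_approx[OF u(1) d(1) _ d(2) zX w(1) e(4) j(1) s]) (use that j(2) e(2) in auto)
    moreover have "N (w j - u' s) \<le> \<eta> / 3"
      using w(2) s e(3) j(3)[of w] N_commute[OF wX X(2)] by force
    ultimately show ?thesis using tri_via[OF X wX] by simp
  qed
  then have "N (u s - u' s) \<le> 0" by (rule field_le_epsilon)
  moreover have "0 \<le> N (u s - u' s)" using X by (intro N_nonneg mem)
  ultimately show ?thesis
    using normed_space_onD(2)[OF nsp, of "u s - u' s"] X by auto
qed

end

section \<open>Existence of mild solutions\<close>

locale banach_accretive_operator = accretive_operator +
  assumes complete: "Metric_space.mcomplete X (norm_dist X N)"
    and range: "range_condition X N A"
begin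

lemma Cauchy_limit:
  assumes f: "\<And>n. f n \<in> X" and cauchy: "\<And>e. 0 < e \<Longrightarrow> \<exists>M. \<forall>m\<ge>M. \<forall>n\<ge>M. N (f m - f n) < e"
  obtains l where "l \<in> X" "(\<lambda>n. N (f n - l)) \<longlonglongrightarrow> 0"
proof -
  interpret Metric_space X "norm_dist X N" by (rule Metric_space_norm_dist[OF nsp])
  have "MCauchy f"
    unfolding MCauchy_def using f cauchy by (auto simp: norm_dist_def)
  then obtain l where "limitin mtopology f l sequentially"
    using complete unfolding mcomplete_def by blast
  then have "l \<in> X" "(\<lambda>n. norm_dist X N (f n) l) \<longlonglongrightarrow> 0"
    unfolding limitin_metric_dist_null by auto
  then show thesis using f by (intro that[of l]) (auto simp: norm_dist_def)
qed

text \<open>A step of the implicit scheme lands in the domain, hence in its closure, so the range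
  condition can be applied again; the start alone may lie outside the domain.\<close>

lemma euler_scheme_exists:
  obtains \<delta> where "0 < \<delta>" "\<And>l z. 0 < l \<Longrightarrow> l < \<delta> \<Longrightarrow> z \<in> dom_closure \<Longrightarrow>
    \<exists>v. v 0 = z \<and> (\<forall>i. v i \<in> X \<and> (v (Suc i), (v i - v (Suc i)) /\<^sub>R l) \<in> A)"
proof -
  obtain \<delta> where \<delta>: "0 < \<delta>"
    "\<forall>l\<in>{0<..<\<delta>}. dom_closure \<subseteq> Range (op_plus (Id_on X) (op_scale l A))"
    using range unfolding range_condition_def by blast
  show thesis
  proof (rule that[OF \<delta>(1)])
    fix l z assume l: "0 < l" "l < \<delta>" and z: "z \<in> dom_closure"
    have step: "\<exists>x. (x, (p - x) /\<^sub>R l) \<in> A" if p: "p \<in> dom_closure" for p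
    proof -
      have "p \<in> Range (op_plus (Id_on X) (op_scale l A))" using \<delta>(2) l p by auto
      then obtain x y where "(x, y) \<in> A" "p = x + l *\<^sub>R y"
        unfolding op_plus_def op_scale_def by auto
      then show ?thesis using l by (intro exI[of _ x]) simp
    qed
    have "\<exists>v. \<forall>n. (v n \<in> dom_closure \<and> (n = 0 \<longrightarrow> v n = z)) \<and> (v (Suc n), (v n - v (Suc n)) /\<^sub>R l) \<in> A"
    proof (rule dependent_nat_choice)
      show "\<exists>x. x \<in> dom_closure \<and> (0 = (0::nat) \<longrightarrow> x = z)" using z by simp
      fix x and n :: nat assume "x \<in> dom_closure \<and> (n = 0 \<longrightarrow> x = z)"
      then obtain x' where x': "(x', (x - x') /\<^sub>R l) \<in> A" using step by blast
      then show "\<exists>y. (y \<in> dom_closure \<and> (Suc n = 0 \<longrightarrow> y = z)) \<and> (y, (x - y) /\<^sub>R l) \<in> A"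
        by (intro exI[of _ x']) (auto dest: Domain_subset_closure)
    qed
    then show "\<exists>v. v 0 = z \<and> (\<forall>i. v i \<in> X \<and> (v (Suc i), (v i - v (Suc i)) /\<^sub>R l) \<in> A)"
      using closure_iff by blast
  qed
qed

lemma euler_approx_solution:
  assumes v: "v 0 = z" "\<And>i. v i \<in> X" "\<And>i. (v (Suc i), (v i - v (Suc i)) /\<^sub>R l) \<in> A"
    and l: "0 < l" "l \<le> e" and T: "0 \<le> T"
  shows "approx_solution X N A z e T (nat \<lfloor>T / l\<rfloor>) (\<lambda>i. real i * l) v (\<lambda>_. 0)"
proof -
  define K where "K = nat \<lfloor>T / l\<rfloor>"
  have "real K \<le> T / l" "T / l < real K + 1"
    using l T by (auto simp: K_def)
  then have K: "real K * l \<le> T" "T < real K * l + l"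
    using l by (auto simp: field_simps)
  have "\<exists>y\<in>A `` {v i}. 0 = (v i - v (i - 1)) /\<^sub>R (real i * l - real (i - 1) * l) + y"
    if "i \<in> {1..K}" for i
  proof -
    obtain i' where i': "i = Suc i'" using \<open>i \<in> {1..K}\<close> by (cases i) auto
    have eq: "real (Suc i') * l - real i' * l = l" by (simp add: algebra_simps)
    show ?thesis
      unfolding i' diff_Suc_1 eq using v(3)[of i'] by (intro bexI[of _ "(v i' - v (Suc i')) /\<^sub>R l"])
        (auto simp: scaleR_add_right[symmetric])
  qed
  moreover have "real (i - 1) * l < real i * l \<and> real i * l - real (i - 1) * l \<le> e" if "i \<in> {1..K}" for i
    using that l by (auto simp: of_nat_diff algebra_simps)
  ultimately show ?thesis
    unfolding approx_solution_def discretization_def K_def[symmetric]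
    using v(1,2) l K by auto
qed

theorem mild_solution_exists:
  assumes z: "z \<in> dom_closure"
  obtains u where "mild_solution X N A z u"
proof -
  obtain \<delta>0 where \<delta>0: "0 < \<delta>0" "\<And>l z. 0 < l \<Longrightarrow> l < \<delta>0 \<Longrightarrow> z \<in> dom_closure \<Longrightarrow>
    \<exists>v. v 0 = z \<and> (\<forall>i. v i \<in> X \<and> (v (Suc i), (v i - v (Suc i)) /\<^sub>R l) \<in> A)"
    using euler_scheme_exists by blast
  \<comment> \<open>Steps of at most 1 guarantee that rounding a time up to a grid point overshoots
    by at most 1, which is why the estimates below extend to \<open>T + 1\<close>.\<close>
  define \<delta> where "\<delta> = min 1 (\<delta>0 / 2)"
  have \<delta>: "0 < \<delta>" "\<delta> \<le> 1" "\<delta> < \<delta>0" using \<delta>0(1) by (auto simp: \<delta>_def)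
  define l where "l m = \<delta> / real (Suc m)" for m
  have l: "0 < l m" "l m \<le> 1" "l m < \<delta>0" for m
  proof -
    have "l m \<le> \<delta> / 1" unfolding l_def using \<delta> by (intro divide_left_mono) auto
    then show "0 < l m" "l m \<le> 1" "l m < \<delta>0" using \<delta> by (auto simp: l_def)
  qed
  have l_lim: "l \<longlonglongrightarrow> 0"
    unfolding l_def[abs_def] by (rule LIMSEQ_Suc[OF lim_const_over_n])
  have "\<forall>m. \<exists>v. v 0 = z \<and> (\<forall>i. v i \<in> X \<and> (v (Suc i), (v i - v (Suc i)) /\<^sub>R l m) \<in> A)"
    using \<delta>0(2)[OF l(1,3) z] by blast
  then obtain v where v: "\<And>m. v m 0 = z" "\<And>m i. v m i \<in> X"
    "\<And>m i. (v m (Suc i), (v m i - v m (Suc i)) /\<^sub>R l m) \<in> A" by metis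
  have as: "approx_solution X N A z e T (nat \<lfloor>T / l m\<rfloor>) (\<lambda>i. real i * l m) (v m) (\<lambda>_. 0)"
    if "l m \<le> e" "0 \<le> T" for m e T
    using v l that by (intro euler_approx_solution) auto
  \<comment> \<open>The width \<open>3 * d\<close> is a budget: \<open>d\<close> for rounding a time
    on one grid, \<open>d\<close> for rounding on another, and \<open>d\<close> for moving the time
    itself when continuity of the limit is shown.\<close>
  have close: "\<exists>d>0. \<exists>M. (\<forall>m\<ge>M. l m \<le> d) \<and> (\<forall>m\<ge>M. \<forall>n\<ge>M. \<forall>i j. real i * l m \<le> T + 1 \<longrightarrow>
      real j * l n \<le> T + 1 \<longrightarrow> \<bar>real i * l m - real j * l n\<bar> \<le> 3 * d \<longrightarrow> N (v m i - v n j) \<le> \<eta>)"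
    if T: "0 \<le> T" and \<eta>: "0 < \<eta>" for T \<eta>
  proof -
    obtain d where d: "0 < d" "approx_close X N A z (T + 1) \<eta> d"
      using approx_close_exists[OF z _ \<eta>, of "T + 1"] T by auto
    obtain M where M: "\<forall>m\<ge>M. l m < d / 3"
      using order_tendstoD(2)[OF l_lim, of "d / 3"] d(1) by (auto simp: eventually_sequentially)
    show ?thesis
    proof (intro exI[of _ "d / 3"] exI[of _ M] conjI allI impI)
      show "0 < d / 3" using d(1) by simp
      show "l m \<le> d / 3" if "M \<le> m" for m using M that by (simp add: less_imp_le)
      fix m n i j
      assume *: "M \<le> m" "M \<le> n" "real i * l m \<le> T + 1" "real j * l n \<le> T + 1"
        "\<bar>real i * l m - real j * l n\<bar> \<le> 3 * (d / 3)"
      have le: "l m \<le> d" "l n \<le> d" using M[rule_format, OF *(1)] M[rule_format, OF *(2)] d(1) by auto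
      have ij: "i \<le> nat \<lfloor>(T + 1) / l m\<rfloor>" "j \<le> nat \<lfloor>(T + 1) / l n\<rfloor>"
        using *(3,4) l(1) by (simp_all add: le_nat_floor pos_le_divide_eq)
      show "N (v m i - v n j) \<le> \<eta>"
        using approx_closeD[OF d(2) as[OF le(1)] as[OF le(2)] order_refl order_refl ij] T *(5) by simp
    qed
  qed
  \<comment> \<open>Rounding up gives index 0 at time 0, so the limit starts exactly at
    \<open>z\<close>.\<close>
  define idx where "idx m s = nat \<lceil>s / l m\<rceil>" for m s
  have idx: "\<bar>s - real (idx m s) * l m\<bar> \<le> l m" "real (idx m s) * l m \<le> s + 1" if "0 \<le> s" for m s
  proof -
    have "s / l m \<le> real (idx m s)" "real (idx m s) \<le> s / l m + 1"
      using that l(1)[of m] by (auto simp: idx_def of_nat_nat ceiling_le_iff)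
    then have "s \<le> real (idx m s) * l m" "real (idx m s) * l m \<le> s + l m"
      using l(1)[of m] by (auto simp: field_simps)
    then show "\<bar>s - real (idx m s) * l m\<bar> \<le> l m" "real (idx m s) * l m \<le> s + 1"
      using l(2)[of m] by auto
  qed
  have "\<exists>p. p \<in> X \<and> (\<lambda>m. N (v m (idx m s) - p)) \<longlonglongrightarrow> 0" if s: "0 \<le> s" for s
  proof -
    have "\<exists>M. \<forall>m\<ge>M. \<forall>n\<ge>M. N (v m (idx m s) - v n (idx n s)) < e" if "0 < e" for e
    proof -
      obtain d M where dM: "0 < d" "\<forall>m\<ge>M. l m \<le> d" "\<forall>m\<ge>M. \<forall>n\<ge>M. \<forall>i j. real i * l m \<le> s + 1 \<longrightarrow>
        real j * l n \<le> s + 1 \<longrightarrow> \<bar>real i * l m - real j * l n\<bar> \<le> 3 * d \<longrightarrow> N (v m i - v n j) \<le> e / 2"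
        using close[OF s, of "e / 2"] \<open>0 < e\<close> by auto
      show ?thesis
      proof (intro exI[of _ M] allI impI)
        fix m n assume mn: "M \<le> m" "M \<le> n"
        have "N (v m (idx m s) - v n (idx n s)) \<le> e / 2"
        proof (rule dM(3)[rule_format, OF mn idx(2)[OF s] idx(2)[OF s]])
          have "l m \<le> d" "l n \<le> d" using dM(2) mn by auto
          then show "\<bar>real (idx m s) * l m - real (idx n s) * l n\<bar> \<le> 3 * d"
            using idx(1)[OF s, of m] idx(1)[OF s, of n] dM(1) by linarith
        qed
        then show "N (v m (idx m s) - v n (idx n s)) < e" using \<open>0 < e\<close> by simp
      qed
    qed
    then show ?thesis using Cauchy_limit[of "\<lambda>m. v m (idx m s)"] v(2) by metis
  qed
  then obtain u where u: "\<And>s. 0 \<le> s \<Longrightarrow> u s \<in> X" "\<And>s. 0 \<le> s \<Longrightarrow> (\<lambda>m. N (v m (idx m s) - u s)) \<longlonglongrightarrow> 0"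
    by metis
  have limit_le: "N (u s - p) \<le> \<eta>"
    if s: "0 \<le> s" and p: "p \<in> X" and ev: "\<And>m. M \<le> m \<Longrightarrow> N (v m (idx m s) - p) \<le> \<eta>" for s p \<eta> M
  proof (rule LIMSEQ_le_const[where X = "\<lambda>m. N (v m (idx m s) - u s) + \<eta>"])
    show "(\<lambda>m. N (v m (idx m s) - u s) + \<eta>) \<longlonglongrightarrow> \<eta>"
      using tendsto_add[OF u(2)[OF s] tendsto_const[of \<eta>]] by simp
    have "N (u s - p) \<le> N (v m (idx m s) - u s) + \<eta>" if "M \<le> m" for m
      using tri_via[of "u s" p "v m (idx m s)"] ev[OF that] u(1)[OF s] p v(2)
        N_commute[of "u s" "v m (idx m s)"] by simp
    then show "\<exists>M. \<forall>m\<ge>M. N (u s - p) \<le> N (v m (idx m s) - u s) + \<eta>" by blast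
  qed
  have u_close: "\<exists>d>0. \<exists>M. (\<forall>m\<ge>M. l m \<le> d) \<and>
      (\<forall>m\<ge>M. \<forall>i s. 0 \<le> s \<longrightarrow> s \<le> T \<longrightarrow> real i * l m \<le> T + 1 \<longrightarrow> \<bar>s - real i * l m\<bar> \<le> 2 * d \<longrightarrow> N (u s - v m i) \<le> \<eta>)"
    if T: "0 \<le> T" and \<eta>: "0 < \<eta>" for T \<eta>
  proof -
    obtain d M where dM: "0 < d" "\<forall>m\<ge>M. l m \<le> d" "\<forall>m\<ge>M. \<forall>n\<ge>M. \<forall>i j. real i * l m \<le> T + 1 \<longrightarrow>
      real j * l n \<le> T + 1 \<longrightarrow> \<bar>real i * l m - real j * l n\<bar> \<le> 3 * d \<longrightarrow> N (v m i - v n j) \<le> \<eta>"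
      using close[OF T \<eta>] by auto
    have "N (u s - v m i) \<le> \<eta>"
      if *: "M \<le> m" "0 \<le> s" "s \<le> T" "real i * l m \<le> T + 1" "\<bar>s - real i * l m\<bar> \<le> 2 * d" for m i s
    proof (rule limit_le[OF *(2) v(2), of M])
      fix n assume n: "M \<le> n"
      have "\<bar>s - real (idx n s) * l n\<bar> \<le> d" using idx(1)[OF *(2), of n] dM(2) n by force
      then show "N (v n (idx n s) - v m i) \<le> \<eta>"
        using idx(2)[OF *(2), of n] *(3,5) by (intro dM(3)[rule_format, OF n *(1) _ *(4)]) linarith+
    qed
    then show ?thesis using dM(1,2) by (intro exI[of _ d] conjI exI[of _ M]) auto
  qed
  have cont: "continuous_map (top_of_set {0..}) (norm_topology X N) u"
    unfolding continuous_map_norm_iff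
  proof (intro ballI conjI allI impI)
    fix s :: real assume s: "s \<in> {0..}"
    then show "u s \<in> X" using u(1) by simp
    fix e :: real assume e: "0 < e"
    obtain d M where dM: "0 < d" "\<forall>m\<ge>M. l m \<le> d"
      "\<forall>m\<ge>M. \<forall>i r. 0 \<le> r \<longrightarrow> r \<le> s + 1 \<longrightarrow> real i * l m \<le> (s + 1) + 1 \<longrightarrow> \<bar>r - real i * l m\<bar> \<le> 2 * d
        \<longrightarrow> N (u r - v m i) \<le> e / 3"
      using u_close[of "s + 1" "e / 3"] s e by auto
    show "\<exists>d>0. \<forall>s'\<in>{0..}. \<bar>s' - s\<bar> < d \<longrightarrow> u s' \<in> X \<and> N (u s - u s') < e"
    proof (intro exI[of _ "min 1 d"] conjI ballI impI)
      show "0 < min 1 d" using dM(1) by simp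
      fix s' :: real assume s': "s' \<in> {0..}" "\<bar>s' - s\<bar> < min 1 d"
      then show X: "u s' \<in> X" using u(1) by simp
      have i: "\<bar>s - real (idx M s) * l M\<bar> \<le> d" "real (idx M s) * l M \<le> s + 1"
        using idx[of s M] s dM(2) by force+
      have "N (u s - v M (idx M s)) \<le> e / 3" "N (u s' - v M (idx M s)) \<le> e / 3"
        by (rule dM(3)[rule_format]; use i s s' dM(1) in \<open>auto simp: abs_if split: if_splits\<close>)+
      then show "N (u s - u s') < e"
        using tri_via[of "u s" "u s'" "v M (idx M s)"] N_commute[of "u s'" "v M (idx M s)"]
          u(1)[of s] X v(2) s e by simp
    qed
  qed
  moreover have "mild_solution_on X N A z T u" if T: "0 < T" for T
    unfolding mild_solution_on_def
  proof (intro conjI allI impI)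
    show "continuous_map (top_of_set {0..T}) (norm_topology X N) u"
      using continuous_map_from_subtopology_mono[OF cont, of "{0..T}"] by auto
    have "N (u 0 - z) = 0"
      using u(2)[of 0] LIMSEQ_const_iff[of "N (z - u 0)" 0] v(1) u(1)[of 0] z closure_iff[of z]
      by (simp add: idx_def N_commute)
    then show "u 0 = z"
      using normed_space_onD(2)[OF nsp, of "u 0 - z"] u(1)[of 0] z closure_iff[of z] by auto
    fix e :: real assume e: "0 < e"
    obtain d M where dM: "0 < d" "\<forall>m\<ge>M. l m \<le> d"
      "\<forall>m\<ge>M. \<forall>i s. 0 \<le> s \<longrightarrow> s \<le> T \<longrightarrow> real i * l m \<le> T + 1 \<longrightarrow> \<bar>s - real i * l m\<bar> \<le> 2 * d
        \<longrightarrow> N (u s - v m i) \<le> e"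
      using u_close[of T e] T e by auto
    obtain M' where "\<forall>m\<ge>M'. l m < e"
      using order_tendstoD(2)[OF l_lim e] by (auto simp: eventually_sequentially)
    then obtain m where m: "M \<le> m" "l m \<le> e" by (meson le_cases less_imp_le)
    have lm: "l m \<le> 2 * d" using dM(1,2) m(1) by force
    \<comment> \<open>The scheme is also taken with its true mesh as error: this places a node
      within \<open>l m\<close> of \<open>s\<close>, whereas the tolerance \<open>e\<close> may
      exceed the gap \<open>2 * d\<close> that \<open>dM\<close> admits.\<close>
    have sol: "approx_solution X N A z (l m) T (nat \<lfloor>T / l m\<rfloor>) (\<lambda>i. real i * l m) (v m) (\<lambda>_. 0)"
      using T by (intro as) auto
    show "\<exists>K t v \<theta>. approx_solution X N A z e T K t v \<theta> \<and> (\<forall>s\<in>{0..T}. N (u s - step_interp K t v s) \<le> e)"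
    proof (intro exI conjI ballI)
      show "approx_solution X N A z e T (nat \<lfloor>T / l m\<rfloor>) (\<lambda>i. real i * l m) (v m) (\<lambda>_. 0)"
        using T m(2) by (intro as) auto
      fix s assume s: "s \<in> {0..T}"
      have "discretization (l m) T (nat \<lfloor>T / l m\<rfloor>) (\<lambda>i. real i * l m)"
        using sol unfolding approx_solution_def by blast
      from step_interp_index[OF this s less_imp_le[OF l(1)]]
      obtain i where i: "i \<le> nat \<lfloor>T / l m\<rfloor>" "\<bar>s - real i * l m\<bar> \<le> l m"
        "\<And>v::nat \<Rightarrow> 'a. step_interp (nat \<lfloor>T / l m\<rfloor>) (\<lambda>i. real i * l m) v s = v i"
        by metis
      have "real i * l m \<le> T" by (rule approx_solution_time_le[OF sol i(1)])
      then show "N (u s - step_interp (nat \<lfloor>T / l m\<rfloor>) (\<lambda>i. real i * l m) (v m) s) \<le> e"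
        unfolding i(3) using s i(2) lm by (intro dM(3)[rule_format, OF m(1)]) auto
    qed
  qed
  ultimately have "mild_solution X N A z u" unfolding mild_solution_def by blast
  then show thesis by (rule that)
qed

lemma mild_semigroup_solution:
  assumes z: "z \<in> dom_closure"
  shows "mild_solution X N A z (\<lambda>t. mild_semigroup X N A t z)"
proof -
  obtain u where u: "mild_solution X N A z u" using mild_solution_exists[OF z] .
  \<comment> \<open>The horizon \<open>t + 1\<close> is positive even for \<open>t = 0\<close>, as
    \<open>mild_solution\<close> requires.\<close>
  have "v t = u t" if "mild_solution X N A z v" "0 \<le> t" for v t
    using that u mild_solution_on_unique[OF _ _ z, of "t + 1" v u t] unfolding mild_solution_def by simp
  then have "z \<in> mild_semigroup_domain X N A"
    using u z closure_iff unfolding mild_semigroup_domain_def by blast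
  then have eq: "mild_semigroup X N A t z = u t" if "0 \<le> t" for t
    using mild_semigroup_eq u that by blast
  have "continuous_map (top_of_set {0..}) (norm_topology X N) (\<lambda>t. mild_semigroup X N A t z)"
    by (rule continuous_map_eq[of _ _ u]) (use u in \<open>auto simp: mild_solution_def eq\<close>)
  moreover have "mild_solution_on X N A z T (\<lambda>t. mild_semigroup X N A t z)" if "0 < T" for T
  proof -
    have uT: "mild_solution_on X N A z T u" using u that unfolding mild_solution_def by blast
    have "continuous_map (top_of_set {0..T}) (norm_topology X N) (\<lambda>t. mild_semigroup X N A t z)"
      by (rule continuous_map_eq[of _ _ u]) (use uT in \<open>auto simp: mild_solution_on_def eq\<close>)
    then show ?thesis using uT unfolding mild_solution_on_def by (simp add: eq)
  qed
  ultimately show ?thesis unfolding mild_solution_def by blast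
qed

end

section \<open>Convergence along a stacking\<close>

locale stacked_banach_spaces =
  fixes X :: "enat \<Rightarrow> 'a::real_vector set"
    and N :: "enat \<Rightarrow> 'a \<Rightarrow> real"
    and \<xi> :: "enat \<Rightarrow> 'a \<Rightarrow> 'm::metric_space"
  assumes stacking: "banach_stacking X N \<xi>"
begin

lemma banach: "banach_space_on (X n) (N n)"
  using stacking unfolding banach_stacking_def by blast

lemma normed: "normed_space_on (X n) (N n)"
  using banach unfolding banach_space_on_def by blast

lemma subspace: "subspace (X n)"
  using normed_space_onD(1)[OF normed] .

lemma X_mem [simp, intro]: "x \<in> X n \<Longrightarrow> y \<in> X n \<Longrightarrow> x + y \<in> X n"
  "x \<in> X n \<Longrightarrow> y \<in> X n \<Longrightarrow> x - y \<in> X n" "x \<in> X n \<Longrightarrow> c *\<^sub>R x \<in> X n"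
  using subspace[of n] by (auto intro: subspace_add subspace_diff subspace_scale)

lemma dist_le: "x \<in> X n \<Longrightarrow> y \<in> X n \<Longrightarrow> dist (\<xi> n x) (\<xi> n y) \<le> N n (x - y)"
  using stacking unfolding banach_stacking_def by blast

lemma approximable:
  assumes "p \<in> X \<infinity>"
  obtains x where "\<And>n. x n \<in> X (enat n)" "stack_tendsto \<xi> x p"
  using stacking assms unfolding banach_stacking_def by blast

text \<open>\<open>stack_tendsto\<close> does not see the carriers; this adds the memberships under
  which the stacking axioms hold.\<close>

definition stacked :: "(nat \<Rightarrow> 'a) \<Rightarrow> 'a \<Rightarrow> bool" where
  "stacked x p \<longleftrightarrow> (\<forall>n. x n \<in> X (enat n)) \<and> p \<in> X \<infinity> \<and> stack_tendsto \<xi> x p"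

lemma stacked_add: "stacked x p \<Longrightarrow> stacked y q \<Longrightarrow> stacked (\<lambda>n. x n + y n) (p + q)"
  using stacking unfolding banach_stacking_def stacked_def by auto

lemma stacked_scale: "stacked x p \<Longrightarrow> stacked (\<lambda>n. c *\<^sub>R x n) (c *\<^sub>R p)"
  using stacking unfolding banach_stacking_def stacked_def by auto

lemma stacked_diff: "stacked x p \<Longrightarrow> stacked y q \<Longrightarrow> stacked (\<lambda>n. x n - y n) (p - q)"
  using stacked_add[of x p "\<lambda>n. (-1) *\<^sub>R y n" "(-1) *\<^sub>R q"] stacked_scale[of y q "-1"] by simp

lemma stacked_norm: "stacked x p \<Longrightarrow> (\<lambda>n. N (enat n) (x n)) \<longlonglongrightarrow> N \<infinity> p"
  using stacking unfolding banach_stacking_def stacked_def by blast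

text \<open>With \<open>(p, q)\<close> the pair that solves the resolvent equation at the limit and
  \<open>(x n, y n)\<close> its approximants, the defects \<open>z n - (x n + l y n)\<close>
  converge along the stacking to 0, hence so do their norms. Accretivity bounds the distance from
  the resolvent to \<open>x n\<close> by the defect divided by \<open>1 - l * \<omega>\<close>, and
  the maps \<xi> are 1-Lipschitz.\<close>

lemma resolvent_convergence:
  assumes A: "\<And>n. A n \<subseteq> X n \<times> X n"
    and acc: "\<And>n x y x' y'. (x, y) \<in> A n \<Longrightarrow> (x', y') \<in> A n \<Longrightarrow>
      (1 - l * \<omega>) * N n (x - x') \<le> N n (x - x' + l *\<^sub>R (y - y'))"
    and l: "l * \<omega> < 1"
    and approx: "\<And>p q. (p, q) \<in> A \<infinity> \<Longrightarrow>
      \<exists>x y. (\<forall>n. (x n, y n) \<in> A (enat n)) \<and> stack_tendsto \<xi> x p \<and> stack_tendsto \<xi> y q"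
    and z: "\<And>n. z n \<in> X n" "stack_tendsto \<xi> (\<lambda>n. z (enat n)) (z \<infinity>)"
    and dom: "z \<infinity> \<in> Domain (resolvent (X \<infinity>) l (A \<infinity>))"
      "\<forall>\<^sub>F n in sequentially. z (enat n) \<in> Domain (resolvent (X (enat n)) l (A (enat n)))"
  shows "stack_tendsto \<xi>
    (\<lambda>n. op_apply (resolvent (X (enat n)) l (A (enat n))) (z (enat n)))
    (op_apply (resolvent (X \<infinity>) l (A \<infinity>)) (z \<infinity>))"
proof -
  have res: "(p, x) \<in> resolvent (X n) l (A n) \<longleftrightarrow> (\<exists>y. (x, y) \<in> A n \<and> p = x + l *\<^sub>R y)" for p x n
    using A[of n] unfolding resolvent_def op_plus_def op_scale_def by auto
  have N0: "N n 0 = 0" for n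
    using normed_space_onD(2)[OF normed subspace_0[OF subspace]] by simp
  have eq: "op_apply (resolvent (X n) l (A n)) p = x" if "(x, y) \<in> A n" "p = x + l *\<^sub>R y" for p x y n
    unfolding op_apply_def res
  proof (rule the_equality)
    fix x' assume "\<exists>y. (x', y) \<in> A n \<and> p = x' + l *\<^sub>R y"
    then obtain y' where y': "(x', y') \<in> A n" "p = x' + l *\<^sub>R y'" by blast
    have "x' - x + l *\<^sub>R (y' - y) = (x' + l *\<^sub>R y') - (x + l *\<^sub>R y)" by (simp add: algebra_simps)
    also have "\<dots> = 0" using that(2) y'(2) by simp
    finally have "(1 - l * \<omega>) * N n (x' - x) \<le> 0"
      using acc[OF y'(1) that(1)] N0[of n] by simp
    then have "N n (x' - x) \<le> 0" using l by (simp add: mult_le_0_iff)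
    moreover have X: "x' - x \<in> X n" using that(1) y'(1) A[of n] by auto
    ultimately show "x' = x"
      using normed_space_onD(2)[OF normed X] normed_space_on_nonneg[OF normed X] by simp
  qed (use that in blast)
  obtain p q where pq: "(p, q) \<in> A \<infinity>" "z \<infinity> = p + l *\<^sub>R q" using dom(1) res by blast
  obtain x y where xy: "\<And>n. (x n, y n) \<in> A (enat n)" "stack_tendsto \<xi> x p" "stack_tendsto \<xi> y q"
    using approx[OF pq(1)] by blast
  have xyX: "x n \<in> X (enat n)" "y n \<in> X (enat n)" for n using xy(1)[of n] A by auto
  have "stacked x p" "stacked y q" "stacked (\<lambda>n. z (enat n)) (z \<infinity>)"
    using xy xyX pq A[of \<infinity>] z unfolding stacked_def by auto
  then have "stacked (\<lambda>n. z (enat n) - (x n + l *\<^sub>R y n)) (z \<infinity> - (p + l *\<^sub>R q))"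
    by (intro stacked_diff stacked_add stacked_scale)
  from stacked_norm[OF this] have lim: "(\<lambda>n. N (enat n) (z (enat n) - (x n + l *\<^sub>R y n))) \<longlonglongrightarrow> 0"
    using pq(2) N0 by simp
  define R where "R n = op_apply (resolvent (X (enat n)) l (A (enat n))) (z (enat n))" for n
  have bd: "\<forall>\<^sub>F n in sequentially. dist (\<xi> (enat n) (R n)) (\<xi> (enat n) (x n))
      \<le> N (enat n) (z (enat n) - (x n + l *\<^sub>R y n)) / (1 - l * \<omega>)"
    using dom(2)
  proof eventually_elim
    case (elim n)
    then obtain a b where ab: "(a, b) \<in> A (enat n)" "z (enat n) = a + l *\<^sub>R b" using res by blast
    have R: "R n = a" unfolding R_def using eq[OF ab] .
    have "a - x n + l *\<^sub>R (b - y n) = z (enat n) - (x n + l *\<^sub>R y n)"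
      unfolding ab(2) by (simp add: algebra_simps)
    then have "(1 - l * \<omega>) * N (enat n) (a - x n) \<le> N (enat n) (z (enat n) - (x n + l *\<^sub>R y n))"
      using acc[OF ab(1) xy(1)[of n]] by (simp only:)
    then have "N (enat n) (a - x n) \<le> N (enat n) (z (enat n) - (x n + l *\<^sub>R y n)) / (1 - l * \<omega>)"
      using l by (simp add: field_simps)
    then show ?case
      using dist_le[of a "enat n" "x n"] ab(1) A[of "enat n"] xyX unfolding R by force
  qed
  have "(\<lambda>n. N (enat n) (z (enat n) - (x n + l *\<^sub>R y n)) / (1 - l * \<omega>)) \<longlonglongrightarrow> 0"
    using tendsto_divide[OF lim tendsto_const[of "1 - l * \<omega>"]] l by simp
  from tendsto_sandwich[OF _ bd tendsto_const this]
  have "(\<lambda>n. dist (\<xi> (enat n) (R n)) (\<xi> (enat n) (x n))) \<longlonglongrightarrow> 0" by simp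
  moreover have "(\<lambda>n. dist (\<xi> (enat n) (x n)) (\<xi> \<infinity> p)) \<longlonglongrightarrow> 0"
    using xy(2) unfolding stack_tendsto_def tendsto_dist_iff[of _ "\<xi> \<infinity> p"] .
  ultimately have sum: "(\<lambda>n. dist (\<xi> (enat n) (R n)) (\<xi> (enat n) (x n))
      + dist (\<xi> (enat n) (x n)) (\<xi> \<infinity> p)) \<longlonglongrightarrow> 0"
    by (rule tendsto_add_zero)
  have "(\<lambda>n. dist (\<xi> (enat n) (R n)) (\<xi> \<infinity> p)) \<longlonglongrightarrow> 0"
    by (rule tendsto_sandwich[OF _ _ tendsto_const sum]) (simp_all add: dist_triangle)
  then have "(\<lambda>n. \<xi> (enat n) (R n)) \<longlonglongrightarrow> \<xi> \<infinity> p"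
    unfolding tendsto_dist_iff[of _ "\<xi> \<infinity> p"] .
  then show ?thesis unfolding stack_tendsto_def R_def eq[OF pq] .
qed

end

locale stacked_operators = stacked_banach_spaces X N \<xi>
  for X :: "enat \<Rightarrow> 'a::real_vector set" and N and \<xi> :: "enat \<Rightarrow> 'a \<Rightarrow> 'm::metric_space" +
  fixes A :: "enat \<Rightarrow> ('a \<times> 'a) set" and \<omega> :: real
  assumes operators: "\<And>n. banach_accretive_operator (X n) (N n) (A n) \<omega>"
    and approx: "\<And>p q. (p, q) \<in> A \<infinity> \<Longrightarrow>
      \<exists>x y. (\<forall>n. (x n, y n) \<in> A (enat n)) \<and> stack_tendsto \<xi> x p \<and> stack_tendsto \<xi> y q"
begin

sublocale op: banach_accretive_operator "X n" "N n" "A n" \<omega> for n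
  by (rule operators)

lemma approx_stacked:
  assumes "(p, q) \<in> A \<infinity>"
  obtains x y where "\<And>n. (x n, y n) \<in> A (enat n)" "stacked x p" "stacked y q"
proof -
  obtain x y where xy: "\<And>n. (x n, y n) \<in> A (enat n)" "stack_tendsto \<xi> x p" "stack_tendsto \<xi> y q"
    using approx[OF assms] by blast
  have "x n \<in> X (enat n)" "y n \<in> X (enat n)" for n using xy(1)[of n] op.operator by auto
  then show thesis
    using that[OF xy(1)] xy assms op.operator[of \<infinity>] unfolding stacked_def by auto
qed

text \<open>\<Theta> is defined so that the inclusion holds exactly for the lifted nodes. It is a
  fixed linear combination of stacked sequences, so it converges to \<theta>, and the gap between
  \<open>e\<close> and \<open>e'\<close> absorbs the deviations of the finitely many norms.\<close>

lemma lift_approx_solution: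
  assumes as: "approx_solution (X \<infinity>) (N \<infinity>) (A \<infinity>) p e T K t v \<theta>"
    and z: "stacked z p" and e: "e < e'"
  obtains V \<Theta> where "\<And>i. i \<le> K \<Longrightarrow> stacked (\<lambda>n. V n i) (v i)"
    "\<forall>\<^sub>F n in sequentially. approx_solution (X (enat n)) (N (enat n)) (A (enat n)) (z n) e' T K t (V n) (\<Theta> n)"
proof -
  note D = op.approx_solutionD[OF as]
  define y where "y i = \<theta> (Suc i) - (v (Suc i) - v i) /\<^sub>R (t (Suc i) - t i)" for i
  have "\<forall>i. \<exists>a b. i < K \<longrightarrow> (\<forall>n. (a n, b n) \<in> A (enat n)) \<and> stacked a (v (Suc i)) \<and> stacked b (y i)"
    using approx_stacked[OF D(9)] unfolding y_def by metis
  then obtain a b where ab: "\<And>i n. i < K \<Longrightarrow> (a i n, b i n) \<in> A (enat n)"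
    "\<And>i. i < K \<Longrightarrow> stacked (a i) (v (Suc i))" "\<And>i. i < K \<Longrightarrow> stacked (b i) (y i)"
    by metis
  \<comment> \<open>The initial node need not lie in the domain; it is lifted by the approximation
    axiom of the stacking instead.\<close>
  obtain c where c: "stacked c (v 0)"
    using approximable[of "v 0"] D(6)[of 0] unfolding stacked_def by auto
  define V where "V n i = (case i of 0 \<Rightarrow> c n | Suc l \<Rightarrow> a l n)" for n i
  define \<Theta> where "\<Theta> n i = (case i of 0 \<Rightarrow> 0
    | Suc l \<Rightarrow> (V n (Suc l) - V n l) /\<^sub>R (t (Suc l) - t l) + b l n)" for n i
  have V: "stacked (\<lambda>n. V n i) (v i)" if "i \<le> K" for i
    using that c ab(2) by (cases i) (auto simp: V_def)
  have \<Theta>: "stacked (\<lambda>n. \<Theta> n (Suc i)) (\<theta> (Suc i))" if "i < K" for i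
  proof -
    have "stacked (\<lambda>n. (V n (Suc i) - V n i) /\<^sub>R (t (Suc i) - t i) + b i n)
      ((v (Suc i) - v i) /\<^sub>R (t (Suc i) - t i) + y i)"
      using V[of i] V[of "Suc i"] ab(3)[OF that] that
      by (intro stacked_add stacked_scale stacked_diff) auto
    then show ?thesis by (simp add: \<Theta>_def y_def)
  qed
  have \<Theta>0: "\<Theta> n 0 = 0" for n by (simp add: \<Theta>_def)
  have \<Theta>X: "\<Theta> n i \<in> X (enat n)" if "i \<le> K" for n i
    using \<Theta>[of "i - 1"] that \<Theta>0[of n] by (cases i) (auto simp: stacked_def)
  have init: "\<forall>\<^sub>F n in sequentially. N (enat n) (V n 0 - z n) < e'"
    using order_tendstoD(2)[OF stacked_norm[OF stacked_diff[OF V[of 0] z]]] D(8) e by simp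
  have "(\<lambda>n. \<Sum>i<K. (t (Suc i) - t i) * N (enat n) (\<Theta> n (Suc i)))
      \<longlonglongrightarrow> (\<Sum>i<K. (t (Suc i) - t i) * N \<infinity> (\<theta> (Suc i)))"
    by (intro tendsto_sum tendsto_mult tendsto_const stacked_norm[OF \<Theta>]) simp
  then have err: "\<forall>\<^sub>F n in sequentially. (\<Sum>i<K. (t (Suc i) - t i) * N (enat n) (\<Theta> n (Suc i))) < e'"
    by (rule order_tendstoD(2)) (use D(10) e in simp)
  have disc: "discretization e' T K t"
    using as e unfolding approx_solution_def discretization_def by fastforce
  have "\<forall>\<^sub>F n in sequentially.
      approx_solution (X (enat n)) (N (enat n)) (A (enat n)) (z n) e' T K t (V n) (\<Theta> n)"
    using init err
  proof eventually_elim
    case (elim n)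
    show ?case
      unfolding approx_solution_def sum_steps_shift[of t]
    proof (intro conjI disc \<Theta>0 allI impI ballI)
      show "V n i \<in> X (enat n)" if "i \<le> K" for i using V[OF that] by (simp add: stacked_def)
      show "\<Theta> n i \<in> X (enat n)" if "i \<le> K" for i using \<Theta>X[OF that] .
      fix i assume "i \<in> {1..K}"
      then obtain l where l: "i = Suc l" "l < K" by (cases i) auto
      have "(V n (Suc l), b l n) \<in> A (enat n)" using ab(1)[OF l(2)] by (simp add: V_def)
      then show "\<exists>y\<in>A (enat n) `` {V n i}. \<Theta> n i = (V n i - V n (i - 1)) /\<^sub>R (t i - t (i - 1)) + y"
        unfolding l(1) by (intro bexI[of _ "b l n"]) (auto simp: \<Theta>_def)
    qed (use elim in auto)
  qed
  then show thesis using that V by blast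
qed

text \<open>Each time \<open>s\<close> is served by one of finitely many nodes, so convergence at
  each node becomes uniform in \<open>s\<close>; the passage from nodes to solutions is uniform by
  closeness.\<close>

lemma semigroup_uniform_convergence:
  assumes z: "\<And>n. z n \<in> norm_topology (X n) (N n) closure_of Domain (A n)"
      "stack_tendsto \<xi> (\<lambda>n. z (enat n)) (z \<infinity>)"
    and T: "0 < T" and \<eta>: "0 < \<eta>"
  shows "\<forall>\<^sub>F n in sequentially. \<forall>s\<in>{0..T}. dist
    (\<xi> (enat n) (mild_semigroup (X (enat n)) (N (enat n)) (A (enat n)) s (z (enat n))))
    (\<xi> \<infinity> (mild_semigroup (X \<infinity>) (N \<infinity>) (A \<infinity>) s (z \<infinity>))) \<le> \<eta>"
proof -
  define u where "u n s = mild_semigroup (X n) (N n) (A n) s (z n)" for n s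
  have u: "mild_solution_on (X n) (N n) (A n) (z n) T (u n)" for n
    using op.mild_semigroup_solution[OF z(1)[of n]] T unfolding mild_solution_def u_def by blast
  have zX: "z n \<in> X n" for n using z(1) op.closure_iff by blast
  then have zs: "stacked (\<lambda>n. z (enat n)) (z \<infinity>)" using z(2) by (simp add: stacked_def)
  \<comment> \<open>Of the four parts, two go to the solution against its lifted node, one to the
    node against its limit, one to the limit node against the limit solution.\<close>
  define \<eta>' where "\<eta>' = \<eta> / 4"
  have \<eta>': "0 < \<eta>'" using \<eta> by (simp add: \<eta>'_def)
  obtain r where r: "0 < r"
    "\<And>Y. \<exists>d>0. \<forall>(X::'a set) N A z x y. accretive_operator X N A \<omega> \<longrightarrow> z \<in> X \<longrightarrow>
      (x, y) \<in> A \<longrightarrow> N (z - x) \<le> r \<longrightarrow> N y \<le> Y \<longrightarrow> approx_close X N A z T \<eta>' d"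
    using approx_close_uniform[OF op.omega_nonneg less_imp_le[OF T] \<eta>'] by metis
  obtain p q where pq: "(p, q) \<in> A \<infinity>" "N \<infinity> (z \<infinity> - p) < r"
    using z(1)[of \<infinity>] r(1) unfolding op.closure_iff by blast
  obtain x y where xy: "\<And>n. (x n, y n) \<in> A (enat n)" "stacked x p" "stacked y q"
    using approx_stacked[OF pq(1)] by blast
  \<comment> \<open>The norms of \<open>y n\<close> converge to \<open>N \<infinity> q\<close>, so
    they are eventually below \<open>Y\<close>.\<close>
  define Y where "Y = N \<infinity> q + 1"
  obtain d where d: "0 < d" "\<And>X N A z x y. accretive_operator (X::'a set) N A \<omega> \<Longrightarrow> z \<in> X \<Longrightarrow>
      (x, y) \<in> A \<Longrightarrow> N (z - x) \<le> r \<Longrightarrow> N y \<le> Y \<Longrightarrow> approx_close X N A z T \<eta>' d"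
    using r(2)[of Y] by metis
  have "\<forall>\<^sub>F n in sequentially. N (enat n) (z (enat n) - x n) < r"
    by (rule order_tendstoD(2)[OF stacked_norm[OF stacked_diff[OF zs xy(2)]] pq(2)])
  moreover have "\<forall>\<^sub>F n in sequentially. N (enat n) (y n) < Y"
    by (rule order_tendstoD(2)[OF stacked_norm[OF xy(3)]]) (simp add: Y_def)
  ultimately have close: "\<forall>\<^sub>F n in sequentially.
      approx_close (X (enat n)) (N (enat n)) (A (enat n)) (z (enat n)) T \<eta>' d"
    by eventually_elim (rule d(2)[OF op.accretive_operator_axioms zX xy(1)], auto)
  \<comment> \<open>Lifting doubles the error, and \<open>2 * e\<close> must still be at most
    \<open>d\<close>.\<close>
  define e where "e = min (d / 4) \<eta>'"
  have e: "0 < e" "e < 2 * e" "2 * e \<le> d" "e \<le> d / 2" "e \<le> \<eta>'" using d(1) \<eta>' by (auto simp: e_def)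
  obtain K t v \<theta> where v: "approx_solution (X \<infinity>) (N \<infinity>) (A \<infinity>) (z \<infinity>) e T K t v \<theta>"
    "\<forall>s\<in>{0..T}. N \<infinity> (u \<infinity> s - step_interp K t v s) \<le> e"
    using u[of \<infinity>] e(1) unfolding mild_solution_on_def by blast
  have disc: "discretization e T K t" using v(1) by (simp add: approx_solution_def)
  obtain V \<Theta> where V: "\<And>i. i \<le> K \<Longrightarrow> stacked (\<lambda>n. V n i) (v i)"
    "\<forall>\<^sub>F n in sequentially. approx_solution (X (enat n)) (N (enat n)) (A (enat n)) (z (enat n)) (2 * e) T K t (V n) (\<Theta> n)"
    using lift_approx_solution[OF v(1) zs e(2)] by blast
  have "\<forall>\<^sub>F n in sequentially. dist (\<xi> (enat n) (V n i)) (\<xi> \<infinity> (v i)) < \<eta>'" if "i \<in> {..K}" for i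
    using V(1)[of i] that \<eta>' unfolding stacked_def stack_tendsto_def by (auto dest: tendstoD)
  then have "\<forall>\<^sub>F n in sequentially. \<forall>i\<in>{..K}. dist (\<xi> (enat n) (V n i)) (\<xi> \<infinity> (v i)) < \<eta>'"
    by (intro eventually_ball_finite) auto
  with close V(2) have "\<forall>\<^sub>F n in sequentially. \<forall>s\<in>{0..T}. dist (\<xi> (enat n) (u (enat n) s)) (\<xi> \<infinity> (u \<infinity> s)) \<le> \<eta>"
  proof eventually_elim
    case (elim n)
    show ?case
    proof
      fix s assume s: "s \<in> {0..T}"
      obtain i where i: "i \<le> K" "\<bar>s - t i\<bar> \<le> e" "\<And>v::nat \<Rightarrow> 'a. step_interp K t v s = v i"
        using step_interp_index[OF disc s less_imp_le[OF e(1)]] by metis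
      have X: "u (enat n) s \<in> X (enat n)" "u \<infinity> s \<in> X \<infinity>" "V n i \<in> X (enat n)" "v i \<in> X \<infinity>"
        using op.mild_solution_onD(2)[OF u s] V(1)[OF i(1)] by (auto simp: stacked_def)
      have "N (enat n) (u (enat n) s - V n i) \<le> 2 * \<eta>'"
        using i(2) e(4)
        by (intro op.mild_solution_near_approx[OF u d(1) \<eta>' elim(1) zX elim(2) e(3) i(1) s]) simp
      then have "dist (\<xi> (enat n) (u (enat n) s)) (\<xi> (enat n) (V n i)) \<le> 2 * \<eta>'"
        using dist_le[OF X(1,3)] by simp
      moreover have "dist (\<xi> (enat n) (V n i)) (\<xi> \<infinity> (v i)) \<le> \<eta>'"
        using elim(3) i(1) by (simp add: less_imp_le)
      moreover have "dist (\<xi> \<infinity> (u \<infinity> s)) (\<xi> \<infinity> (v i)) \<le> \<eta>'"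
        using dist_le[OF X(2,4)] v(2) s e(5) i(3)[of v] by force
      ultimately show "dist (\<xi> (enat n) (u (enat n) s)) (\<xi> \<infinity> (u \<infinity> s)) \<le> \<eta>"
        using dist_triangle[of "\<xi> (enat n) (u (enat n) s)" "\<xi> \<infinity> (u \<infinity> s)" "\<xi> (enat n) (V n i)"]
          dist_triangle2[of "\<xi> (enat n) (V n i)" "\<xi> \<infinity> (u \<infinity> s)" "\<xi> \<infinity> (v i)"]
        unfolding \<eta>'_def by linarith
    qed
  qed
  then show ?thesis unfolding u_def .
qed

end

text \<open>The value of a resolvent has a meaning only on its domain, and the range condition
  ensures membership only for \<open>l\<close> below a threshold depending on the operator; hence
  the domain conditions, at the limit and for almost all indices. The supremum is taken in
  \<open>ereal\<close>, where it exists without a boundedness argument.\<close>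

theorem proposition7p1:
  fixes X :: "enat \<Rightarrow> 'a::real_vector set"
    and N :: "enat \<Rightarrow> 'a \<Rightarrow> real"
    and \<xi> :: "enat \<Rightarrow> 'a \<Rightarrow> 'm::metric_space"
    and A :: "enat \<Rightarrow> ('a \<times> 'a) set"
    and w :: "enat \<Rightarrow> real"
    and \<omega> :: real
  assumes stacking: "banach_stacking X N \<xi>"
    and operator: "\<And>n. A n \<subseteq> X n \<times> X n"
    and accretive: "\<And>n. omega_accretive (X n) (N n) (w n) (A n)"
    and range: "\<And>n. range_condition (X n) (N n) (A n)"
    and bound: "\<And>n. w n \<le> \<omega>"
    and approx: "\<And>p q. (p, q) \<in> A \<infinity> \<Longrightarrow>
      \<exists>x y. (\<forall>n. (x n, y n) \<in> A (enat n)) \<and> stack_tendsto \<xi> x p \<and> stack_tendsto \<xi> y q"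
  shows
    "(\<forall>l\<in>resolvent_interval \<omega>. \<forall>z.
        (\<forall>n. z n \<in> norm_topology (X n) (N n) closure_of Domain (A n)) \<and>
        stack_tendsto \<xi> (\<lambda>n. z (enat n)) (z \<infinity>) \<and>
        z \<infinity> \<in> Domain (resolvent (X \<infinity>) l (A \<infinity>)) \<and>
        (\<forall>\<^sub>F n in sequentially.
           z (enat n) \<in> Domain (resolvent (X (enat n)) l (A (enat n)))) \<longrightarrow>
          stack_tendsto \<xi>
            (\<lambda>n. op_apply (resolvent (X (enat n)) l (A (enat n))) (z (enat n)))
            (op_apply (resolvent (X \<infinity>) l (A \<infinity>)) (z \<infinity>))) \<and>
     (\<forall>z.
        (\<forall>n. z n \<in> norm_topology (X n) (N n) closure_of Domain (A n)) \<and>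
        stack_tendsto \<xi> (\<lambda>n. z (enat n)) (z \<infinity>) \<longrightarrow>
          (\<forall>t\<ge>0. stack_tendsto \<xi>
            (\<lambda>n. mild_semigroup (X (enat n)) (N (enat n)) (A (enat n)) t (z (enat n)))
            (mild_semigroup (X \<infinity>) (N \<infinity>) (A \<infinity>) t (z \<infinity>))) \<and>
          (\<forall>T\<ge>0. (\<lambda>n. SUP t\<in>{0..T}. ereal (dist
              (\<xi> (enat n) (mild_semigroup (X (enat n)) (N (enat n)) (A (enat n)) t (z (enat n))))
              (\<xi> \<infinity> (mild_semigroup (X \<infinity>) (N \<infinity>) (A \<infinity>) t (z \<infinity>))))) \<longlonglongrightarrow> 0))"
proof (intro conjI ballI allI impI; (elim conjE)?)
  interpret stacked_banach_spaces X N \<xi> by unfold_locales (rule stacking)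
  have closure_mem: "p \<in> X n" if "p \<in> norm_topology (X n) (N n) closure_of Domain (A n)" for p n
  proof -
    interpret M: Metric_space "X n" "norm_dist (X n) (N n)" by (rule Metric_space_norm_dist[OF normed])
    show ?thesis using that closure_of_subset_topspace[of M.mtopology] unfolding norm_topology_def by auto
  qed
  {
    fix l z
    assume l: "l \<in> resolvent_interval \<omega>"
      and z: "\<forall>n. z n \<in> norm_topology (X n) (N n) closure_of Domain (A n)"
        "stack_tendsto \<xi> (\<lambda>n. z (enat n)) (z \<infinity>)"
        "z \<infinity> \<in> Domain (resolvent (X \<infinity>) l (A \<infinity>))"
        "\<forall>\<^sub>F n in sequentially. z (enat n) \<in> Domain (resolvent (X (enat n)) l (A (enat n)))"
    have l': "0 < l" "l * \<omega> < 1"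
      using l mult_nonneg_nonpos[of l \<omega>] unfolding resolvent_interval_def
      by (auto simp: field_simps split: if_splits)
    show "stack_tendsto \<xi>
        (\<lambda>n. op_apply (resolvent (X (enat n)) l (A (enat n))) (z (enat n)))
        (op_apply (resolvent (X \<infinity>) l (A \<infinity>)) (z \<infinity>))"
      using z closure_mem omega_accretiveD[OF normed operator accretive bound _ _ l'(1)]
      by (intro resolvent_convergence[OF operator _ l'(2) approx]) auto
  }
  \<comment> \<open>The locale wants a nonnegative constant, and enlarging \<omega> only weakens the
    accretivity inequality.\<close>
  interpret stacked_operators X N \<xi> A "max \<omega> 0"
  proof unfold_locales
    fix n x y x' y' and l :: real
    assume "(x, y) \<in> A n" "(x', y') \<in> A n" "0 < l"
    then show "(1 - l * max \<omega> 0) * N n (x - x') \<le> N n (x - x' + l *\<^sub>R (y - y'))"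
      using bound[of n] by (intro omega_accretiveD[OF normed operator accretive]) auto
  qed (use banach banach_space_on_def normed operator range approx in auto)
  {
    fix z and t :: real
    assume z: "\<forall>n. z n \<in> norm_topology (X n) (N n) closure_of Domain (A n)"
      "stack_tendsto \<xi> (\<lambda>n. z (enat n)) (z \<infinity>)" and t: "0 \<le> t"
    show "stack_tendsto \<xi>
        (\<lambda>n. mild_semigroup (X (enat n)) (N (enat n)) (A (enat n)) t (z (enat n)))
        (mild_semigroup (X \<infinity>) (N \<infinity>) (A \<infinity>) t (z \<infinity>))"
      unfolding stack_tendsto_def
    proof (rule tendstoI)
      fix \<eta> :: real assume \<eta>: "0 < \<eta>"
      show "\<forall>\<^sub>F n in sequentially. dist
          (\<xi> (enat n) (mild_semigroup (X (enat n)) (N (enat n)) (A (enat n)) t (z (enat n))))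
          (\<xi> \<infinity> (mild_semigroup (X \<infinity>) (N \<infinity>) (A \<infinity>) t (z \<infinity>))) < \<eta>"
        using semigroup_uniform_convergence[OF z(1)[rule_format] z(2), of "t + 1" "\<eta> / 2"] t \<eta>
        by (auto elim!: eventually_mono dest!: bspec[of _ _ t])
    qed
  }
  {
    fix z and T :: real
    assume z: "\<forall>n. z n \<in> norm_topology (X n) (N n) closure_of Domain (A n)"
      "stack_tendsto \<xi> (\<lambda>n. z (enat n)) (z \<infinity>)" and T: "0 \<le> T"
    define f where "f n t = dist
        (\<xi> (enat n) (mild_semigroup (X (enat n)) (N (enat n)) (A (enat n)) t (z (enat n))))
        (\<xi> \<infinity> (mild_semigroup (X \<infinity>) (N \<infinity>) (A \<infinity>) t (z \<infinity>)))" for n t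
    have "(\<lambda>n. SUP t\<in>{0..T}. ereal (f n t)) \<longlonglongrightarrow> 0"
    proof (rule order_tendstoI)
      fix a :: ereal assume a: "a < 0"
      \<comment> \<open>The interval contains 0; over an empty set the supremum in
        \<open>ereal\<close> would be minus infinity.\<close>
      have pos: "0 \<le> (SUP t\<in>{0..T}. ereal (f n t))" for n
        using T by (intro SUP_upper2[of 0]) (auto simp: f_def)
      then show "\<forall>\<^sub>F n in sequentially. a < (SUP t\<in>{0..T}. ereal (f n t))"
        by (intro always_eventually allI less_le_trans[OF a pos])
    next
      fix a :: ereal assume "0 < a"
      then obtain \<eta> where \<eta>: "0 < ereal \<eta>" "ereal \<eta> < a" using ereal_dense2 by blast
      have "\<forall>\<^sub>F n in sequentially. \<forall>s\<in>{0..T + 1}. f n s \<le> \<eta>"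
        unfolding f_def using T \<eta>(1)
        by (intro semigroup_uniform_convergence[OF z(1)[rule_format] z(2)]) auto
      then show "\<forall>\<^sub>F n in sequentially. (SUP t\<in>{0..T}. ereal (f n t)) < a"
      proof eventually_elim
        case (elim n)
        then have "(SUP t\<in>{0..T}. ereal (f n t)) \<le> ereal \<eta>" by (intro SUP_least) auto
        then show ?case using \<eta>(2) by simp
      qed
    qed
    then show "(\<lambda>n. SUP t\<in>{0..T}. ereal (dist
        (\<xi> (enat n) (mild_semigroup (X (enat n)) (N (enat n)) (A (enat n)) t (z (enat n))))
        (\<xi> \<infinity> (mild_semigroup (X \<infinity>) (N \<infinity>) (A \<infinity>) t (z \<infinity>))))) \<longlonglongrightarrow> 0"
      unfolding f_def .
  }
qed

end
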